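(* Let $X$ be a Tychonoff space. The following conditions are equivalent: (1) the space $X$ has the property $(\kappa)$; (2) the space $C_p(X)$ is $\kappa$-Fréchet-Urysohn; (3) the space $C_p(X,[0,1])$ is $\kappa$-Fréchet-Urysohn; (4) the space $C_p(X)$ is Ascoli; (5) the space $C_p(X)$ does not have the Banakh property; (6) every pairwise disjoint sequence of non-empty finite subsets of $X$ has a strongly $Coz_\delta$-disjoint subsequence; (7) the space $B_1(X)$ is Baire.
   Context: All spaces are Tychonoff. $C_p(X)$ is the set of all continuous functions $X\to\mathbb{R}$ with the topology of pointwise convergence; $C_p(X,[0,1])$ is the set of continuous functions $X\to[0,1]$ with the topology of pointwise convergence. A function $f:X\to\mathbb{R}$ is Baire-one if it is the pointwise limit of a sequence of continuous real-valued functions on $X$; $B_1(X)$ is the set of all Baire-one functions on $X$ with the topology of pointwise convergence. A family $\{A_\alpha:\alpha\in I\}$ of subsets of a set $X$ is point-finite if for every $x\in X$ the set $\{\alpha\in I: x\in A_\alpha\}$ is finite. A family $\{A_\alpha:\alpha\in I\}$ of subsets of a space $X$ is strongly point-finite if for every $\alpha\in I$ there is an open set $U_\alpha$ of $X$ with $A_\alpha\subseteq U_\alpha$ such that $\{U_\alpha:\alpha\in I\}$ is point-finite. $X$ has the property $(\kappa)$ if every pairwise disjoint sequence of finite subsets of $X$ has a strongly point-finite subsequence. A space $Y$ is $\kappa$-Fréchet-Urysohn if for every open set $U\subseteq Y$ and every point $y\in\overline{U}$ there is a sequence in $U$ converging to $y$. $C_k(Y)$ is the set of continuous functions $Y\to\mathbb{R}$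 with the compact-open topology. A space $Y$ is Ascoli if every compact subset $K$ of $C_k(Y)$ is evenly continuous, i.e. the map $K\times Y\to\mathbb{R}$, $(f,y)\mapsto f(y)$, is continuous. A space $Y$ has the Banakh property if there is a countable family $\{A_n:n\in\mathbb{N}\}$ of closed nowhere dense subsets of $Y$ such that for every compact subset $K$ of $Y$ there is $n\in\mathbb{N}$ with $K\subseteq A_n$. A zero-set of $X$ is a set of the form $f^{-1}(0)$ with $f:X\to\mathbb{R}$ continuous; a cozero-set is the complement of a zero-set; a $Coz_\delta$-set is a countable intersection of cozero-sets. A $Coz_\delta$ neighborhood of $x$ is a $Coz_\delta$-subset of $X$ containing $x$. A set $A\subseteq X$ is strongly $Coz_\delta$-disjoint if there is a pairwise disjoint collection $\{F_a:a\in A\}$, where $F_a$ is a $Coz_\delta$ neighborhood of $a$, such that $\bigcup_{b\in B}F_b$ is a $Coz_\delta$-set for each $B\subseteq A$. A disjoint sequence $\{\Delta_n:n\in\mathbb{N}\}$ of finite subsets of $X$ is strongly $Coz_\delta$-disjoint if the set $\bigcup_{n\in\mathbb{N}}\Delta_n$ is strongly $Coz_\delta$-disjoint. A topological space is Baire if the intersection of any sequence of its open dense subsets is dense. *)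

theory Defs
  imports "HOL-Analysis.Analysis"
begin

text \<open>The library's \<^const>\<open>completely_regular_space\<close> does not include any separation of points.\<close>
definition tychonoff_space :: "'a topology \<Rightarrow> bool" where
  "tychonoff_space X \<longleftrightarrow> completely_regular_space X \<and> Hausdorff_space X"


subsection \<open>Function spaces\<close>

text \<open>A function on the space \<open>X\<close> is represented by its extension by \<^const>\<open>undefined\<close> outside
  \<^term>\<open>topspace X\<close>, in agreement with \<^const>\<open>product_topology\<close>, whose points are
  extensional. The topology of pointwise convergence is the one inherited from the
  product.\<close>

definition C_p :: "'a topology \<Rightarrow> ('a \<Rightarrow> real) topology" where
  "C_p X = subtopology (product_topology (\<lambda>_. euclideanreal) (topspace X))
             {f. continuous_map X euclideanreal f}"

definition C_p_unit :: "'a topology \<Rightarrow> ('a \<Rightarrow> real) topology" where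
  "C_p_unit X = subtopology (product_topology (\<lambda>_. euclideanreal) (topspace X))
             {f. continuous_map X (top_of_set {0..1}) f}"

definition baire_one :: "'a topology \<Rightarrow> ('a \<Rightarrow> real) \<Rightarrow> bool" where
  "baire_one X f \<longleftrightarrow>
     (\<exists>g :: nat \<Rightarrow> 'a \<Rightarrow> real. (\<forall>n. continuous_map X euclideanreal (g n)) \<and>
        (\<forall>x\<in>topspace X. (\<lambda>n. g n x) \<longlonglongrightarrow> f x))"

definition B_1 :: "'a topology \<Rightarrow> ('a \<Rightarrow> real) topology" where
  "B_1 X = subtopology (product_topology (\<lambda>_. euclideanreal) (topspace X)) {f. baire_one X f}"

definition C_k :: "'a topology \<Rightarrow> ('a \<Rightarrow> real) topology" where
  "C_k Y = topology_generated_by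
     {{f \<in> extensional (topspace Y). continuous_map Y euclideanreal f \<and> f ` K \<subseteq> U} | K U.
        compactin Y K \<and> open U}"

lemma topspace_C_p: "topspace (C_p X) = {f \<in> extensional (topspace X). continuous_map X euclideanreal f}"
  by (auto simp: C_p_def PiE_def)

lemma topspace_C_k: "topspace (C_k Y) = {f \<in> extensional (topspace Y). continuous_map Y euclideanreal f}"
proof -
  have "{f \<in> extensional (topspace Y). continuous_map Y euclideanreal f} \<in>
     {{f \<in> extensional (topspace Y). continuous_map Y euclideanreal f \<and> f ` K \<subseteq> U} | K U.
        compactin Y K \<and> open U}"
    by (rule CollectI, rule exI[of _ "{}"], rule exI[of _ UNIV]) auto
  then show ?thesis
    unfolding C_k_def topology_generated_by_topspace by blast
qed


subsection \<open>Property \<open>(\<kappa>)\<close>\<close>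

definition point_finite :: "'a set \<Rightarrow> 'i set \<Rightarrow> ('i \<Rightarrow> 'a set) \<Rightarrow> bool" where
  "point_finite S I A \<longleftrightarrow> (\<forall>x\<in>S. finite {i\<in>I. x \<in> A i})"

definition strongly_point_finite :: "'a topology \<Rightarrow> 'i set \<Rightarrow> ('i \<Rightarrow> 'a set) \<Rightarrow> bool" where
  "strongly_point_finite X I A \<longleftrightarrow>
     (\<exists>U. (\<forall>i\<in>I. openin X (U i) \<and> A i \<subseteq> U i) \<and> point_finite (topspace X) I U)"

definition disjoint_finite_seq :: "'a topology \<Rightarrow> (nat \<Rightarrow> 'a set) \<Rightarrow> bool" where
  "disjoint_finite_seq X \<Delta> \<longleftrightarrow>
     (\<forall>n. finite (\<Delta> n) \<and> \<Delta> n \<subseteq> topspace X) \<and> disjoint_family \<Delta>"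

definition property_kappa :: "'a topology \<Rightarrow> bool" where
  "property_kappa X \<longleftrightarrow>
     (\<forall>\<Delta>. disjoint_finite_seq X \<Delta> \<longrightarrow>
        (\<exists>r :: nat \<Rightarrow> nat. strict_mono r \<and> strongly_point_finite X UNIV (\<Delta> \<circ> r)))"


subsection \<open>Properties of topological spaces\<close>

definition kappa_frechet_urysohn :: "'a topology \<Rightarrow> bool" where
  "kappa_frechet_urysohn Y \<longleftrightarrow>
     (\<forall>U y. openin Y U \<and> y \<in> Y closure_of U \<longrightarrow>
        (\<exists>s :: nat \<Rightarrow> 'a. range s \<subseteq> U \<and> limitin Y s y sequentially))"

definition ascoli_space :: "'a topology \<Rightarrow> bool" where
  "ascoli_space Y \<longleftrightarrow>
     (\<forall>K. compactin (C_k Y) K \<longrightarrow>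
        continuous_map (prod_topology (subtopology (C_k Y) K) Y) euclideanreal (\<lambda>(f, y). f y))"

definition nowhere_dense_in :: "'a topology \<Rightarrow> 'a set \<Rightarrow> bool" where
  "nowhere_dense_in Y A \<longleftrightarrow> A \<subseteq> topspace Y \<and> Y interior_of (Y closure_of A) = {}"

definition banakh_property :: "'a topology \<Rightarrow> bool" where
  "banakh_property Y \<longleftrightarrow>
     (\<exists>A :: nat \<Rightarrow> 'a set. (\<forall>n. closedin Y (A n) \<and> nowhere_dense_in Y (A n)) \<and>
        (\<forall>K. compactin Y K \<longrightarrow> (\<exists>n. K \<subseteq> A n)))"

definition baire_space :: "'a topology \<Rightarrow> bool" where
  "baire_space Y \<longleftrightarrow>
     (\<forall>D :: nat \<Rightarrow> 'a set.
        (\<forall>n. openin Y (D n) \<and> Y closure_of (D n) = topspace Y) \<longrightarrow>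
        Y closure_of (\<Inter>n. D n) = topspace Y)"


subsection \<open>Strong \<open>Coz\<^sub>\<delta>\<close>-disjointness\<close>

definition zero_set :: "'a topology \<Rightarrow> 'a set \<Rightarrow> bool" where
  "zero_set X Z \<longleftrightarrow>
     (\<exists>f. continuous_map X euclideanreal f \<and> Z = {x \<in> topspace X. f x = 0})"

definition cozero_set :: "'a topology \<Rightarrow> 'a set \<Rightarrow> bool" where
  "cozero_set X W \<longleftrightarrow> (\<exists>Z. zero_set X Z \<and> W = topspace X - Z)"

definition coz_delta :: "'a topology \<Rightarrow> 'a set \<Rightarrow> bool" where
  "coz_delta X G \<longleftrightarrow> (\<exists>W :: nat \<Rightarrow> 'a set. (\<forall>n. cozero_set X (W n)) \<and> G = (\<Inter>n. W n))"

definition strongly_coz_delta_disjoint :: "'a topology \<Rightarrow> 'a set \<Rightarrow> bool" where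
  "strongly_coz_delta_disjoint X A \<longleftrightarrow>
     (\<exists>F :: 'a \<Rightarrow> 'a set.
        (\<forall>a\<in>A. coz_delta X (F a) \<and> a \<in> F a) \<and>
        disjoint_family_on F A \<and>
        (\<forall>B. B \<subseteq> A \<longrightarrow> coz_delta X (\<Union>b\<in>B. F b)))"

definition strongly_coz_delta_disjoint_seq :: "'a topology \<Rightarrow> (nat \<Rightarrow> 'a set) \<Rightarrow> bool" where
  "strongly_coz_delta_disjoint_seq X \<Delta> \<longleftrightarrow>
     disjoint_finite_seq X \<Delta> \<and> strongly_coz_delta_disjoint X (\<Union>n. \<Delta> n)"

end

theory Submission
  imports Defs
begin

text \<open>Everything is reduced to property \<open>(\<kappa>)\<close>. Suppose that for infinitely many \<open>n\<close> some continuous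
  \<open>h n\<close> exceeds \<open>n\<close> in absolute value on \<open>\<Delta> n\<close>, while the \<open>h n\<close> are pointwise bounded; then the open
  sets \<open>{x. \<bar>h n x\<bar> > n}\<close> are point-finite, so a subsequence of \<open>\<Delta>\<close> is strongly point-finite. Compact
  subsets of \<open>C_p\<close> (for the Ascoli and Banakh properties) and sequences of continuous functions
  converging to a Baire-one function that lies in suitable dense open sets provide such \<open>h n\<close>.

  For the Baire property of \<open>B_1\<close> one constructs blocks \<open>\<Delta> n\<close> by carrying along simultaneously all
  finitely many partial Banach--Mazur plays, one for each choice of the blocks used so far. After
  passing to a strongly point-finite subsequence, the play that uses exactly the blocks of this
  subsequence converges to a Baire-one function: a limit of continuous functions plus a function
  that is prescribed on the chosen blocks and vanishes on the unchosen ones.\<close>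

subsection \<open>Continuous functions on Tychonoff spaces\<close>

text \<open>Two long implications out of (\<kappa>) meet the same obstacle: finite sets
  \<open>E n\<close> that control open conditions are built one after the other, and only when all
  of them are fixed does (\<kappa>) select the differences \<open>E (Suc n) - E n\<close> that may
  be used. For the \<kappa>-Frechet-Urysohn property this does no harm, since the unselected
  approximating functions can simply be dropped. In a play for the Baire property each move answers
  the previous ones, so a dropped block would invalidate all later moves; hence every selection is
  prepared for in advance. Both proofs split a correction in the same way: on the old finite set the
  error is small and is spread over the whole space, on the new block it is arbitrary and has to be
  confined to a point-finite family. The Ascoli property and the failure of the Banakh property are
  reached from (\<kappa>) through the \<kappa>-Frechet-Urysohn property of \<open>C_p X\<close>: it
  supplies convergent sequences inside prescribed open sets, and a convergent sequence with its
  limit is compact.\<close>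

lemma tychonoff_finite_closedin:
  assumes "tychonoff_space X" "finite F" "F \<subseteq> topspace X"
  shows "closedin X F"
  using assms Hausdorff_imp_t1_space t1_space_closedin_finite
  unfolding tychonoff_space_def by blast

text \<open>A finite Hausdorff subspace is discrete, so any \<open>v\<close> is continuous on it and
  Tietze extension from a compact set applies. The interval \<open>C\<close> will be the whole line,
  \<open>{0..1}\<close>, or a short interval that keeps the extension uniformly small.\<close>

lemma tychonoff_finite_interpolation:
  fixes v :: "'a \<Rightarrow> real"
  assumes X: "tychonoff_space X" and F: "finite F" "F \<subseteq> topspace X"
    and C: "is_interval C" "C \<noteq> {}" "v ` F \<subseteq> C"
  obtains g where "continuous_map X (top_of_set C) g" "\<And>x. x \<in> F \<Longrightarrow> g x = v x"
proof -
  have "Hausdorff_space (subtopology X F)"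
    using X by (simp add: tychonoff_space_def Hausdorff_space_subtopology)
  then have "subtopology X F = discrete_topology F"
    using F by (intro finite_t1_space_imp_discrete_topology Hausdorff_imp_t1_space) auto
  then have "continuous_map (subtopology X F) euclideanreal v"
    by simp
  then show thesis
  proof (rule Tietze_extension_completely_regular[of X F C v, rotated 4])
    fix g assume "continuous_map X euclideanreal g" "g ` topspace X \<subseteq> C" "\<And>x. x \<in> F \<Longrightarrow> g x = v x"
    then show thesis
      by (intro that[of g]) (auto simp: continuous_map_in_subtopology)
  qed (use X C F in \<open>simp_all add: tychonoff_space_def finite_imp_compactin\<close>)
qed

lemma tychonoff_bump:
  assumes X: "tychonoff_space X" and F: "finite F" "F \<subseteq> U" and U: "openin X U"
  obtains \<phi> :: "'a \<Rightarrow> real" where "continuous_map X euclideanreal \<phi>"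
    "\<And>x. x \<in> topspace X \<Longrightarrow> 0 \<le> \<phi> x \<and> \<phi> x \<le> 1"
    "\<And>x. x \<in> F \<Longrightarrow> \<phi> x = 1" "\<And>x. x \<in> topspace X - U \<Longrightarrow> \<phi> x = 0"
proof -
  have "compactin X F"
    using F openin_subset[OF U] by (intro finite_imp_compactin) auto
  moreover have "closedin X (topspace X - U)" "disjnt F (topspace X - U)"
    using F U by (auto simp: disjnt_def)
  ultimately show thesis
  proof (rule Urysohn_completely_regular_compact_closed[of 0 1 X F "topspace X - U", rotated 2])
    fix \<phi> :: "'a \<Rightarrow> real"
    assume "continuous_map X (top_of_set {0..1}) \<phi>" "\<phi> ` (topspace X - U) \<subseteq> {0}" "\<phi> ` F \<subseteq> {1}"
    then show thesis
      by (intro that[of \<phi>]) (auto simp: continuous_map_in_subtopology Pi_iff)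
  qed (use X in \<open>simp_all add: tychonoff_space_def\<close>)
qed

subsection \<open>The topology of pointwise convergence\<close>

text \<open>All three function spaces have this form for a suitable \<open>S\<close>, so basic
  neighbourhoods, closures and limits are described only once.\<close>

definition pointwise :: "'a set \<Rightarrow> ('a \<Rightarrow> real) set \<Rightarrow> ('a \<Rightarrow> real) topology" where
  "pointwise T S = subtopology (product_topology (\<lambda>_. euclideanreal) T) S"

lemma topspace_pointwise: "topspace (pointwise T S) = extensional T \<inter> S"
  by (auto simp: pointwise_def PiE_def)

lemma C_p_eq_pointwise: "C_p X = pointwise (topspace X) {f. continuous_map X euclideanreal f}"
  by (simp add: C_p_def pointwise_def)

lemma C_p_unit_eq_pointwise:
  "C_p_unit X = pointwise (topspace X) {f. continuous_map X (top_of_set {0..1}) f}"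
  by (simp add: C_p_unit_def pointwise_def)

lemma B_1_eq_pointwise: "B_1 X = pointwise (topspace X) {f. baire_one X f}"
  by (simp add: B_1_def pointwise_def)

lemma openin_pointwise_coordinate:
  assumes "x \<in> T" "open V"
  shows "openin (pointwise T S) {f \<in> topspace (pointwise T S). f x \<in> V}"
proof -
  have "continuous_map (pointwise T S) euclideanreal (\<lambda>f. f x)"
    unfolding pointwise_def using assms by (intro continuous_intros) auto
  then show ?thesis
    using assms openin_continuous_map_preimage[of _ euclideanreal "\<lambda>f. f x" V] by auto
qed

lemma openin_pointwise_finite:
  assumes "finite F" "F \<subseteq> T" "\<And>x. x \<in> F \<Longrightarrow> open (V x)"
  shows "openin (pointwise T S) {f \<in> topspace (pointwise T S). \<forall>x\<in>F. f x \<in> V x}"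
  using assms
proof (induction F)
  case (insert x F)
  have "{f \<in> topspace (pointwise T S). \<forall>y\<in>insert x F. f y \<in> V y} =
      {f \<in> topspace (pointwise T S). f x \<in> V x} \<inter> {f \<in> topspace (pointwise T S). \<forall>x\<in>F. f x \<in> V x}"
    by auto
  moreover have "openin (pointwise T S) {f \<in> topspace (pointwise T S). \<forall>x\<in>F. f x \<in> V x}"
    using insert by simp
  ultimately show ?case
    using insert.prems openin_pointwise_coordinate[of x T "V x" S] by (simp add: openin_Int)
qed simp

lemma openin_pointwise_box:
  assumes "finite F" "F \<subseteq> T"
  shows "openin (pointwise T S) {f \<in> topspace (pointwise T S). \<forall>x\<in>F. \<bar>f x - p x\<bar> < e}"
  using openin_pointwise_finite[OF assms, of "\<lambda>x. ball (p x) e" S]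
  by (simp add: dist_real_def abs_minus_commute)

lemma openin_pointwise_contains_box:
  assumes "openin (pointwise T S) U" "f \<in> U"
  obtains F e where "finite F" "F \<subseteq> T" "e > 0"
    "\<And>g. g \<in> topspace (pointwise T S) \<Longrightarrow> (\<And>x. x \<in> F \<Longrightarrow> \<bar>g x - f x\<bar> < e) \<Longrightarrow> g \<in> U"
proof -
  obtain W where W: "openin (product_topology (\<lambda>_. euclideanreal) T) W" "U = W \<inter> S"
    using assms unfolding pointwise_def openin_subtopology by auto
  then obtain V where V: "finite {i \<in> T. V i \<noteq> (UNIV :: real set)}" "\<And>i. i \<in> T \<Longrightarrow> open (V i)"
      "f \<in> Pi\<^sub>E T V" "Pi\<^sub>E T V \<subseteq> W"
    using assms(2) unfolding openin_product_topology_alt by auto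
  define F where "F = {i \<in> T. V i \<noteq> UNIV}"
  have "\<exists>e>0. \<forall>y. \<bar>y - f i\<bar> < e \<longrightarrow> y \<in> V i" if "i \<in> F" for i
    using V that unfolding F_def open_dist by (fastforce simp: dist_real_def PiE_iff)
  then obtain e where e: "\<And>i. i \<in> F \<Longrightarrow> e i > 0" "\<And>i y. i \<in> F \<Longrightarrow> \<bar>y - f i\<bar> < e i \<Longrightarrow> y \<in> V i"
    by metis
  \<comment> \<open>The \<open>1\<close> covers an empty \<open>F\<close>.\<close>
  define d where "d = Min (insert 1 (e ` F))"
  have d: "d > 0" "\<And>i. i \<in> F \<Longrightarrow> d \<le> e i"
    using V(1) e(1) by (auto simp: d_def F_def)
  show thesis
  proof (rule that[of F d])
    fix g assume g: "g \<in> topspace (pointwise T S)" "\<And>x. x \<in> F \<Longrightarrow> \<bar>g x - f x\<bar> < d"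
    have "g i \<in> V i" if "i \<in> T" for i
      using that e(2)[of i "g i"] d(2)[of i] g(2)[of i] by (fastforce simp: F_def)
    then have "g \<in> Pi\<^sub>E T V"
      using g by (auto simp: topspace_pointwise PiE_iff)
    then show "g \<in> U"
      using V g W by (auto simp: topspace_pointwise)
  qed (use V d in \<open>auto simp: F_def\<close>)
qed

lemma in_closure_of_pointwise:
  assumes "f \<in> topspace (pointwise T S)"
  shows "f \<in> pointwise T S closure_of A \<longleftrightarrow>
    (\<forall>F e. finite F \<and> F \<subseteq> T \<and> e > 0 \<longrightarrow> 
       (\<exists>g\<in>A. g \<in> topspace (pointwise T S) \<and> (\<forall>x\<in>F. \<bar>g x - f x\<bar> < e)))" (is "?L \<longleftrightarrow> ?R")
proof
  assume L: ?L
  show ?R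
  proof (intro strip)
    fix F and e :: real assume F: "finite F \<and> F \<subseteq> T \<and> e > 0"
    define B where "B = {g \<in> topspace (pointwise T S). \<forall>x\<in>F. \<bar>g x - f x\<bar> < e}"
    have "openin (pointwise T S) B" "f \<in> B"
      using F assms by (auto simp: B_def openin_pointwise_box)
    with L obtain g where "g \<in> A" "g \<in> B"
      unfolding in_closure_of by meson
    then show "\<exists>g\<in>A. g \<in> topspace (pointwise T S) \<and> (\<forall>x\<in>F. \<bar>g x - f x\<bar> < e)"
      unfolding B_def by blast
  qed
next
  assume R: ?R
  show ?L
    unfolding in_closure_of
  proof (intro conjI strip assms)
    fix U assume "f \<in> U \<and> openin (pointwise T S) U"
    then obtain F e where "finite F" "F \<subseteq> T" "e > 0"
      "\<And>g. g \<in> topspace (pointwise T S) \<Longrightarrow> (\<And>x. x \<in> F \<Longrightarrow> \<bar>g x - f x\<bar> < e) \<Longrightarrow> g \<in> U"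
      using openin_pointwise_contains_box by metis
    with R show "\<exists>g. g \<in> A \<and> g \<in> U" by meson
  qed
qed

lemma limitin_pointwise:
  "limitin (pointwise T S) s f sequentially \<longleftrightarrow>
     f \<in> topspace (pointwise T S) \<and> (\<forall>\<^sub>F n in sequentially. s n \<in> topspace (pointwise T S)) \<and>
     (\<forall>x\<in>T. (\<lambda>n. s n x) \<longlonglongrightarrow> f x)"
  unfolding pointwise_def limitin_subtopology limitin_componentwise
  by (auto simp: PiE_def eventually_conj_iff)

lemma compactin_pointwise_bounded:
  assumes "compactin (pointwise T S) K" "x \<in> T"
  obtains M where "\<And>f. f \<in> K \<Longrightarrow> \<bar>f x\<bar> \<le> M"
proof -
  have "continuous_map (pointwise T S) euclideanreal (\<lambda>f. f x)"
    unfolding pointwise_def using assms by (intro continuous_intros) auto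
  then have "compact ((\<lambda>f. f x) ` K)"
    using image_compactin[OF assms(1)] by fastforce
  then show thesis
    using that by (metis bounded_real compact_imp_bounded image_eqI)
qed

subsection \<open>Strongly point-finite subsequences\<close>

lemma continuous_map_restrict_topspace:
  "continuous_map X Y f \<Longrightarrow> continuous_map X Y (restrict f (topspace X))"
  by (rule continuous_map_eq) auto

text \<open>Beyond any index \<open>k\<close> exceeds any bound, since otherwise an initial segment
  and finitely many values would cover its range. Monotonicity of \<open>m\<close> will keep a
  family indexed by \<open>m\<close> point-finite, that of \<open>k \<circ> m\<close> makes it a
  choice of subsequence.\<close>

lemma infinite_range_strict_mono_subseq:
  fixes k :: "nat \<Rightarrow> nat"
  assumes "infinite (range k)"
  obtains m :: "nat \<Rightarrow> nat" where "strict_mono m" "strict_mono (k \<circ> m)"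
proof -
  have step: "\<exists>n>M. k n > N" for M N
  proof (rule ccontr)
    assume "\<not> (\<exists>n>M. k n > N)"
    then have "range k \<subseteq> {..N} \<union> k ` {..M}"
      by (auto simp: not_less image_iff)
    with assms show False
      using finite_subset by blast
  qed
  have "\<exists>m. \<forall>n. True \<and> (m n < m (Suc n) \<and> k (m n) < k (m (Suc n)))"
    by (rule dependent_nat_choice) (use step in auto)
  then obtain m where "\<And>n. m n < m (Suc n)" "\<And>n. k (m n) < k (m (Suc n))"
    by blast
  then show thesis
    by (intro that[of m]) (auto simp: strict_mono_Suc_iff)
qed

lemma strongly_point_finite_subseq:
  fixes V \<Delta> :: "nat \<Rightarrow> 'a set" and k :: "nat \<Rightarrow> nat"
  assumes V: "\<And>n. openin X (V n)" "point_finite (topspace X) UNIV V"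
    and sub: "\<And>n. \<Delta> (k n) \<subseteq> V n" and k: "infinite (range k)"
  shows "\<exists>r :: nat \<Rightarrow> nat. strict_mono r \<and> strongly_point_finite X UNIV (\<Delta> \<circ> r)"
proof -
  obtain m :: "nat \<Rightarrow> nat" where m: "strict_mono m" "strict_mono (k \<circ> m)"
    by (rule infinite_range_strict_mono_subseq[OF k])
  have "finite (m -` {n. x \<in> V n})" if "x \<in> topspace X" for x
    using V(2) that strict_mono_imp_inj_on[OF m(1)]
    by (intro finite_vimageI) (simp_all add: point_finite_def)
  then have "point_finite (topspace X) UNIV (V \<circ> m)"
    by (simp add: point_finite_def vimage_def)
  then have "strongly_point_finite X UNIV (\<Delta> \<circ> (k \<circ> m))"
    using V(1) sub unfolding strongly_point_finite_def by (intro exI[of _ "V \<circ> m"]) auto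
  then show ?thesis
    using m(2) by blast
qed

lemma strongly_point_finite_subseq_of_large:
  fixes h :: "nat \<Rightarrow> 'a \<Rightarrow> real" and \<Delta> :: "nat \<Rightarrow> 'a set"
  assumes cont: "\<And>n. continuous_map X euclideanreal (h n)"
    and large: "\<And>n x. x \<in> \<Delta> (k n) \<Longrightarrow> real n < \<bar>h n x\<bar>"
    and k: "\<And>n. n \<le> k n" and \<Delta>: "\<And>n. \<Delta> n \<subseteq> topspace X"
    and bdd: "\<And>x. x \<in> topspace X \<Longrightarrow> \<exists>M. \<forall>n. \<bar>h n x\<bar> \<le> M"
  shows "\<exists>r :: nat \<Rightarrow> nat. strict_mono r \<and> strongly_point_finite X UNIV (\<Delta> \<circ> r)"
proof (rule strongly_point_finite_subseq)
  define V where "V n = {x \<in> topspace X. \<bar>h n x\<bar> \<in> {real n<..}}" for n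
  show "openin X (V n)" for n
    unfolding V_def by (rule openin_continuous_map_preimage[where Y = euclideanreal])
      (auto intro!: continuous_intros cont)
  show "point_finite (topspace X) UNIV V"
    unfolding point_finite_def
  proof
    fix x assume "x \<in> topspace X"
    then obtain M where "\<And>n. \<bar>h n x\<bar> \<le> M"
      using bdd by blast
    then have "{n \<in> UNIV. x \<in> V n} \<subseteq> {..nat \<lceil>M\<rceil>}"
      by (auto simp: V_def) (smt (verit) of_nat_le_iff real_nat_ceiling_ge)
    then show "finite {n \<in> UNIV. x \<in> V n}"
      using finite_subset by blast
  qed
  show "\<Delta> (k n) \<subseteq> V n" for n
    using large \<Delta> by (auto simp: V_def)
  show "infinite (range k)"
    unfolding infinite_nat_iff_unbounded_le using k by blast
qed

lemma strongly_point_finite_empty: "strongly_point_finite X I (\<lambda>_. {})"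
  unfolding strongly_point_finite_def by (intro exI[of _ "\<lambda>_. {}"]) (auto simp: point_finite_def)

text \<open>Infinitely many empty blocks form a subsequence that empty open sets cover; otherwise
  some tail has no empty block.\<close>

lemma property_kappaI_nonempty:
  assumes "\<And>\<Delta>. disjoint_finite_seq X \<Delta> \<Longrightarrow> (\<And>n. \<Delta> n \<noteq> {}) \<Longrightarrow>
    \<exists>r :: nat \<Rightarrow> nat. strict_mono r \<and> strongly_point_finite X UNIV (\<Delta> \<circ> r)"
  shows "property_kappa X"
  unfolding property_kappa_def
proof (intro strip)
  fix \<Delta> assume \<Delta>: "disjoint_finite_seq X \<Delta>"
  show "\<exists>r :: nat \<Rightarrow> nat. strict_mono r \<and> strongly_point_finite X UNIV (\<Delta> \<circ> r)"
  proof (cases "finite {n. \<Delta> n = {}}")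
    case True
    then obtain N where N: "\<And>n. \<Delta> n = {} \<Longrightarrow> n \<le> N"
      using finite_nat_set_iff_bounded_le by auto
    define q where "q n = n + Suc N" for n
    have q: "strict_mono q"
      by (simp add: q_def strict_mono_def)
    have "disjoint_finite_seq X (\<Delta> \<circ> q)"
      using \<Delta> by (auto simp: disjoint_finite_seq_def disjoint_family_on_def q_def)
    moreover have "(\<Delta> \<circ> q) n \<noteq> {}" for n
      using N[of "q n"] by (auto simp: q_def)
    ultimately obtain r :: "nat \<Rightarrow> nat" where "strict_mono r" "strongly_point_finite X UNIV ((\<Delta> \<circ> q) \<circ> r)"
      using assms[of "\<Delta> \<circ> q"] by metis
    then show ?thesis
      using q by (intro exI[of _ "q \<circ> r"]) (simp add: strict_mono_o comp_assoc)
  next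
    case False
    then have "\<Delta> \<circ> enumerate {n. \<Delta> n = {}} = (\<lambda>_. {})"
      using enumerate_in_set by fastforce
    then show ?thesis
      using False strict_mono_enumerate strongly_point_finite_empty by metis
  qed
qed

text \<open>Points chosen in \<open>\<Delta> n \<inter> F\<close> for all large \<open>n\<close>
  would be infinitely many distinct elements of \<open>F\<close>. A basic pointwise neighbourhood
  depends on finitely many points, so on a suitable block values can be prescribed without leaving
  it.\<close>

lemma disjoint_family_avoids_finite:
  fixes \<Delta> :: "nat \<Rightarrow> 'a set"
  assumes "disjoint_family \<Delta>" "finite F"
  obtains n where "n \<ge> N" "\<Delta> n \<inter> F = {}"
proof -
  have "\<exists>n\<ge>N. \<Delta> n \<inter> F = {}"
  proof (rule ccontr)
    assume "\<not> (\<exists>n\<ge>N. \<Delta> n \<inter> F = {})"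
    then have "\<forall>n\<in>{N..}. \<exists>x. x \<in> \<Delta> n \<inter> F"
      by blast
    then obtain p where p: "\<And>n. n \<ge> N \<Longrightarrow> p n \<in> \<Delta> n \<inter> F"
      unfolding bchoice_iff by auto
    have "inj_on p {N..}"
    proof
      fix i j assume "i \<in> {N..}" "j \<in> {N..}" "p i = p j"
      then have "p i \<in> \<Delta> i \<inter> \<Delta> j"
        using p[of i] p[of j] by auto
      then show "i = j"
        using assms(1) by (auto simp: disjoint_family_on_def)
    qed
    moreover have "p ` {N..} \<subseteq> F"
      using p by auto
    ultimately show False
      using assms(2) inj_on_finite infinite_Ici by blast
  qed
  then show thesis
    using that by blast
qed

subsection \<open>The \<open>\<kappa>\<close>-Frechet-Urysohn property\<close>

lemma restrict_in_pointwise: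
  "continuous_map X Z f \<Longrightarrow>
    restrict f (topspace X) \<in> topspace (pointwise (topspace X) {f. continuous_map X Z f})"
  by (simp add: topspace_pointwise continuous_map_restrict_topspace)

text \<open>The zero function lies in the closure of the open set of functions above
  \<open>1/2\<close> on some block. A sequence in that set converging to zero makes the open sets
  where \<open>s j x > 1/2\<close> point-finite, and each of them contains the block of its
  \<open>s j\<close>.\<close>

lemma kappa_frechet_urysohn_imp_property_kappa:
  fixes C :: "real set"
  assumes X: "tychonoff_space X" and C: "is_interval C" "{0..1} \<subseteq> C"
    and FU: "kappa_frechet_urysohn (pointwise (topspace X) {f. continuous_map X (top_of_set C) f})"
      (is "kappa_frechet_urysohn ?Y")
  shows "property_kappa X"
proof (rule property_kappaI_nonempty)
  fix \<Delta> :: "nat \<Rightarrow> 'a set" assume dfs: "disjoint_finite_seq X \<Delta>" and ne: "\<Delta> n \<noteq> {}" for n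
  have \<Delta>: "finite (\<Delta> n)" "\<Delta> n \<subseteq> topspace X" "disjoint_family \<Delta>" for n
    using dfs by (auto simp: disjoint_finite_seq_def)
  have C01: "0 \<in> C" "1 \<in> C"
    using C(2) by auto
  define U where "U n = {f \<in> topspace ?Y. \<forall>x\<in>\<Delta> n. f x \<in> {1/2<..}}" for n
  define y where "y = restrict (\<lambda>_. 0 :: real) (topspace X)"
  have y: "y \<in> topspace ?Y"
    unfolding y_def using C01 by (intro restrict_in_pointwise) auto
  have "openin ?Y (U n)" for n
    unfolding U_def using \<Delta> by (intro openin_pointwise_finite) auto
  then have "openin ?Y (\<Union>n. U n)"
    by blast
  moreover have "y \<in> ?Y closure_of (\<Union>n. U n)"
    unfolding in_closure_of_pointwise[OF y]
  proof (intro strip)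
    fix F and e :: real assume F: "finite F \<and> F \<subseteq> topspace X \<and> e > 0"
    obtain n where n: "\<Delta> n \<inter> F = {}"
      using disjoint_family_avoids_finite \<Delta>(3) F by metis
    obtain g where g: "continuous_map X (top_of_set C) g"
        "\<And>x. x \<in> \<Delta> n \<union> F \<Longrightarrow> g x = (if x \<in> \<Delta> n then 1 else 0)"
      by (rule tychonoff_finite_interpolation[OF X, of "\<Delta> n \<union> F" C "\<lambda>x. if x \<in> \<Delta> n then 1 else 0"])
        (use F \<Delta> C in auto)
    have gY: "restrict g (topspace X) \<in> topspace ?Y"
      using g(1) by (rule restrict_in_pointwise)
    then have "restrict g (topspace X) \<in> U n"
      using g(2) \<Delta>(2)[of n] by (auto simp: U_def)
    moreover have "\<bar>restrict g (topspace X) x - y x\<bar> < e" if "x \<in> F" for x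
      using g(2)[of x] F n that by (auto simp: y_def)
    ultimately show "\<exists>g\<in>\<Union>n. U n. g \<in> topspace ?Y \<and> (\<forall>x\<in>F. \<bar>g x - y x\<bar> < e)"
      using gY by blast
  qed
  ultimately obtain s where s: "range s \<subseteq> (\<Union>n. U n)" "limitin ?Y s y sequentially"
    using FU unfolding kappa_frechet_urysohn_def by metis
  have "\<forall>j. \<exists>n. s j \<in> U n"
    using s(1) by blast
  then obtain k where k: "\<And>j. s j \<in> U (k j)"
    by metis
  have small: "finite {j. s j x > 1/2}" if "x \<in> topspace X" for x
  proof -
    have "(\<lambda>j. s j x) \<longlonglongrightarrow> 0"
      using s(2) that by (auto simp: limitin_pointwise y_def)
    then have "eventually (\<lambda>j. s j x < 1/2) sequentially"
      by (rule order_tendstoD) simp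
    then show ?thesis
      unfolding eventually_sequentially finite_nat_set_iff_bounded_le
      by (metis mem_Collect_eq less_asym' nat_le_linear)
  qed
  define V where "V j = {x \<in> topspace X. s j x \<in> {1/2<..}}" for j
  show "\<exists>r :: nat \<Rightarrow> nat. strict_mono r \<and> strongly_point_finite X UNIV (\<Delta> \<circ> r)"
  proof (rule strongly_point_finite_subseq[of X V \<Delta> k])
    show "openin X (V j)" for j
      unfolding V_def
      by (rule openin_continuous_map_preimage[where Y = euclideanreal])
        (use k[of j] in \<open>auto simp: U_def topspace_pointwise continuous_map_in_subtopology\<close>)
    show "point_finite (topspace X) UNIV V"
      using small by (auto simp: point_finite_def V_def)
    show "\<Delta> (k j) \<subseteq> V j" for j
      using k[of j] \<Delta>(2) by (auto simp: U_def V_def)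
    \<comment> \<open>If \<open>k\<close> had finite range, one block would serve infinitely many
      \<open>j\<close>, and at any point of this nonempty block \<open>s j\<close> would exceed
      \<open>1/2\<close> infinitely often.\<close>
    show "infinite (range k)"
    proof
      assume "finite (range k)"
      then obtain i where i: "infinite {j. k j = k i}"
        using pigeonhole_infinite[of UNIV k] by auto
      obtain x where x: "x \<in> \<Delta> (k i)"
        using ne by blast
      then have "{j. k j = k i} \<subseteq> {j. s j x > 1/2}"
        using k by (fastforce simp: U_def)
      then show False
        using i small x \<Delta>(2) finite_subset by blast
    qed
  qed
qed

text \<open>The functions \<open>f n \<in> U\<close> are near \<open>y\<close> only on
  \<open>E n\<close>, and agreement with \<open>f n\<close> on \<open>E (Suc n)\<close> guarantees
  membership in \<open>U\<close>. For a selected index, \<open>f (r i)\<close> is kept on the new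
  block and blended, inside the neighbourhood \<open>W i\<close> of that block, into a function
  uniformly close to \<open>y\<close>. Each point lies in finitely many \<open>W i\<close>, so only
  the close part matters in the limit.\<close>

lemma property_kappa_imp_kappa_frechet_urysohn:
  fixes C :: "real set"
  assumes X: "tychonoff_space X" and \<kappa>: "property_kappa X" and C: "is_interval C"
  shows "kappa_frechet_urysohn (pointwise (topspace X) {f. continuous_map X (top_of_set C) f})"
    (is "kappa_frechet_urysohn ?Y")
  unfolding kappa_frechet_urysohn_def
proof (intro strip)
  fix U y assume "openin ?Y U \<and> y \<in> ?Y closure_of U"
  then have U: "openin ?Y U" and ycl: "y \<in> ?Y closure_of U"
    by auto
  have y: "y \<in> topspace ?Y"
    using ycl by (simp add: in_closure_of)
  have "\<exists>f G. f \<in> U \<and> finite G \<and> G \<subseteq> topspace X \<and> (\<forall>x\<in>F. \<bar>f x - y x\<bar> \<le> 1 / real (Suc n)) \<and>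
      (\<forall>g\<in>topspace ?Y. (\<forall>x\<in>G. g x = f x) \<longrightarrow> g \<in> U)"
    if "finite F" "F \<subseteq> topspace X" for F n
  proof -
    have "\<exists>f\<in>U. f \<in> topspace ?Y \<and> (\<forall>x\<in>F. \<bar>f x - y x\<bar> < 1 / real (Suc n))"
      using ycl[unfolded in_closure_of_pointwise[OF y], rule_format, of F "1 / real (Suc n)"] that
      by simp
    then obtain f where f: "f \<in> U" "\<forall>x\<in>F. \<bar>f x - y x\<bar> < 1 / real (Suc n)"
      by blast
    obtain G e where "finite G" "G \<subseteq> topspace X" "e > 0"
      "\<And>g. g \<in> topspace ?Y \<Longrightarrow> (\<And>x. x \<in> G \<Longrightarrow> \<bar>g x - f x\<bar> < e) \<Longrightarrow> g \<in> U"
      using openin_pointwise_contains_box[OF U f(1)] by metis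
    with f show ?thesis
      by (intro exI[of _ f] exI[of _ G]) (auto intro: less_imp_le)
  qed
  then obtain ff GG where fG: "\<And>F n. finite F \<Longrightarrow> F \<subseteq> topspace X \<Longrightarrow>
      ff F n \<in> U \<and> finite (GG F n) \<and> GG F n \<subseteq> topspace X \<and>
      (\<forall>x\<in>F. \<bar>ff F n x - y x\<bar> \<le> 1 / real (Suc n)) \<and>
      (\<forall>g\<in>topspace ?Y. (\<forall>x\<in>GG F n. g x = ff F n x) \<longrightarrow> g \<in> U)"
    by metis
  define E where "E = rec_nat {} (\<lambda>n F. F \<union> GG F n)"
  have E_Suc: "E (Suc n) = E n \<union> GG (E n) n" for n
    by (simp add: E_def)
  have E: "finite (E n) \<and> E n \<subseteq> topspace X" for n
    by (induction n) (use fG in \<open>auto simp: E_Suc\<close>, simp_all add: E_def)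
  define f where "f n = ff (E n) n" for n
  have fU: "f n \<in> U" and f_near: "\<And>x. x \<in> E n \<Longrightarrow> \<bar>f n x - y x\<bar> \<le> 1 / real (Suc n)"
    and f_supp: "\<And>g. g \<in> topspace ?Y \<Longrightarrow> (\<And>x. x \<in> E (Suc n) \<Longrightarrow> g x = f n x) \<Longrightarrow> g \<in> U" for n
    using fG[of "E n" n] E[of n] unfolding f_def E_Suc by auto
  define \<Delta> where "\<Delta> n = E (Suc n) - E n" for n
  have "disjoint_family \<Delta>"
    unfolding \<Delta>_def by (rule disjoint_family_Suc) (simp add: E_Suc)
  then have "disjoint_finite_seq X \<Delta>"
    using E by (auto simp: disjoint_finite_seq_def \<Delta>_def)
  then obtain r :: "nat \<Rightarrow> nat" where r: "strict_mono r" "strongly_point_finite X UNIV (\<Delta> \<circ> r)"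
    using \<kappa> unfolding property_kappa_def by blast
  then obtain W where W: "\<And>i. openin X (W i)" "\<And>i. \<Delta> (r i) \<subseteq> W i" "point_finite (topspace X) UNIV W"
    unfolding strongly_point_finite_def by auto
  have "\<exists>\<phi> :: 'a \<Rightarrow> real. continuous_map X euclideanreal \<phi> \<and> (\<forall>x\<in>topspace X. 0 \<le> \<phi> x \<and> \<phi> x \<le> 1) \<and>
      (\<forall>x\<in>\<Delta> (r i). \<phi> x = 1) \<and> (\<forall>x\<in>topspace X - W i. \<phi> x = 0)" for i
    by (rule tychonoff_bump[OF X _ W(2) W(1), of i]) (use E in \<open>auto simp: \<Delta>_def\<close>)
  then obtain \<phi> :: "nat \<Rightarrow> 'a \<Rightarrow> real" where \<phi>: "\<And>i. continuous_map X euclideanreal (\<phi> i)"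
      "\<And>i x. x \<in> topspace X \<Longrightarrow> 0 \<le> \<phi> i x" "\<And>i x. x \<in> topspace X \<Longrightarrow> \<phi> i x \<le> 1"
      "\<And>i x. x \<in> \<Delta> (r i) \<Longrightarrow> \<phi> i x = 1" "\<And>i x. x \<in> topspace X \<Longrightarrow> x \<notin> W i \<Longrightarrow> \<phi> i x = 0"
    by (metis DiffI)
  define d where "d i = 1 / real (Suc (r i))" for i
  have d0: "d i > 0" for i
    by (simp add: d_def)
  \<comment> \<open>Truncating \<open>f (r i) - y\<close>, instead of taking \<open>y\<close>
    itself, preserves \<open>f (r i)\<close> exactly on \<open>E (r i)\<close>. Moreover
    \<open>h i x\<close> lies between \<open>y x\<close> and \<open>f (r i) x\<close>, hence in the
    interval \<open>C\<close>.\<close>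
  define h where "h i x = y x + max (- d i) (min (d i) (f (r i) x - y x))" for i x
  define g where "g i = (\<lambda>x\<in>topspace X. (1 - \<phi> i x) * h i x + \<phi> i x * f (r i) x)" for i
  have fY: "f n \<in> topspace ?Y" for n
    using fU U openin_subset by blast
  have yC: "y x \<in> C" and fC: "f n x \<in> C" if "x \<in> topspace X" for x n
    using y fY[of n] that by (auto simp: topspace_pointwise continuous_map_in_subtopology)
  have y_cont: "continuous_map X euclideanreal y" and f_cont: "continuous_map X euclideanreal (f n)" for n
    using y fY[of n] by (auto simp: topspace_pointwise continuous_map_in_subtopology)
  have hC: "h i x \<in> C" if "x \<in> topspace X" for i x
  proof (cases "y x \<le> f (r i) x")
    case True
    then have "y x \<le> h i x" "h i x \<le> f (r i) x"
      using d0[of i] by (auto simp: h_def)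
    then show ?thesis
      using C yC fC that unfolding is_interval_1 by blast
  next
    case False
    then have "f (r i) x \<le> h i x" "h i x \<le> y x"
      using d0[of i] by (auto simp: h_def)
    then show ?thesis
      using C yC fC that unfolding is_interval_1 by blast
  qed
  have gY: "g i \<in> topspace ?Y" for i
  proof -
    have "(1 - \<phi> i x) * h i x + \<phi> i x * f (r i) x \<in> C" if "x \<in> topspace X" for x
      using convexD[OF is_interval_convex[OF C] hC[OF that] fC[OF that], of "1 - \<phi> i x" "\<phi> i x"] \<phi> that
      by simp
    moreover have "continuous_map X euclideanreal (\<lambda>x. (1 - \<phi> i x) * h i x + \<phi> i x * f (r i) x)"
      unfolding h_def by (intro continuous_intros \<phi> y_cont f_cont)
    ultimately show ?thesis
      unfolding g_def by (intro restrict_in_pointwise) (auto simp: continuous_map_in_subtopology)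
  qed
  have "g i x = f (r i) x" if x: "x \<in> E (Suc (r i))" for i x
  proof -
    have "x \<in> topspace X"
      using x E by blast
    moreover have "h i x = f (r i) x" if "x \<in> E (r i)"
      using f_near[OF that] unfolding h_def d_def by linarith
    ultimately show ?thesis
      using \<phi>(4)[of x i] x by (cases "x \<in> E (r i)") (auto simp: g_def \<Delta>_def algebra_simps)
  qed
  then have "g i \<in> U" for i
    using f_supp[OF gY] by blast
  moreover have "limitin ?Y g y sequentially"
    unfolding limitin_pointwise
  proof (intro conjI ballI y always_eventually allI gY)
    fix x assume x: "x \<in> topspace X"
    have "finite {i. x \<in> W i}"
      using W(3) x by (simp add: point_finite_def)
    then have "eventually (\<lambda>i. x \<notin> W i) sequentially"
      by (simp add: eventually_cofinite flip: cofinite_eq_sequentially)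
    then have ev: "eventually (\<lambda>i. \<bar>g i x - y x\<bar> \<le> d i) sequentially"
    proof (rule eventually_mono)
      fix i assume "x \<notin> W i"
      then have "g i x = h i x"
        using \<phi>(5) x by (simp add: g_def)
      then show "\<bar>g i x - y x\<bar> \<le> d i"
        using d0[of i] by (simp add: h_def)
    qed
    have "d \<longlonglongrightarrow> 0"
      using LIMSEQ_subseq_LIMSEQ[OF LIMSEQ_Suc[OF lim_inverse_n'] r(1)] by (simp add: d_def[abs_def] o_def)
    then have "(\<lambda>i. g i x - y x) \<longlonglongrightarrow> 0"
      by (rule Lim_null_comparison[rotated]) (use ev in simp)
    then show "(\<lambda>i. g i x) \<longlonglongrightarrow> y x"
      by (simp add: LIM_zero_iff)
  qed
  ultimately show "\<exists>s. range s \<subseteq> U \<and> limitin ?Y s y sequentially"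
    by blast
qed

subsection \<open>The Ascoli property\<close>

lemma topcontinuous_at_realI:
  fixes f :: "'a \<Rightarrow> real"
  assumes "x \<in> topspace X"
    and "\<And>e. e > 0 \<Longrightarrow> \<exists>U. openin X U \<and> x \<in> U \<and> (\<forall>y\<in>U. \<bar>f y - f x\<bar> < e)"
  shows "topcontinuous_at X euclideanreal f x"
  unfolding topcontinuous_at_def
proof (intro conjI strip assms)
  fix V assume "openin euclideanreal V \<and> f x \<in> V"
  then obtain e where e: "e > 0" "\<And>t. \<bar>t - f x\<bar> < e \<Longrightarrow> t \<in> V"
    by (auto simp: open_dist dist_real_def)
  then show "\<exists>U. openin X U \<and> x \<in> U \<and> (\<forall>y\<in>U. f y \<in> V)"
    using assms(2)[OF e(1)] by blast
qed auto

lemma openin_C_k: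
  assumes "compactin Y K" "open U"
  shows "openin (C_k Y) {f \<in> topspace (C_k Y). f ` K \<subseteq> U}"
  unfolding topspace_C_k C_k_def
  by (rule topology_generated_by_Basis, rule CollectI, rule exI[of _ K], rule exI[of _ U])
    (use assms in auto)

text \<open>\<open>C_k Y\<close> need not be first countable, so a cluster point replaces the limit
  of a subsequence. Without one, a finite subcover by sets visited finitely often would account for
  only finitely many indices.\<close>

lemma compactin_sequence_cluster:
  fixes s :: "nat \<Rightarrow> 'a"
  assumes K: "compactin Y K" and s: "range s \<subseteq> K"
  obtains l where "l \<in> K" "\<And>U. openin Y U \<Longrightarrow> l \<in> U \<Longrightarrow> infinite {n. s n \<in> U}"
proof -
  have "\<exists>l\<in>K. \<forall>U. openin Y U \<and> l \<in> U \<longrightarrow> infinite {n. s n \<in> U}"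
  proof (rule ccontr)
    assume "\<not> ?thesis"
    then have "\<forall>l\<in>K. \<exists>U. openin Y U \<and> l \<in> U \<and> finite {n. s n \<in> U}"
      by blast
    then obtain U where U: "\<And>l. l \<in> K \<Longrightarrow> openin Y (U l) \<and> l \<in> U l \<and> finite {n. s n \<in> U l}"
      unfolding bchoice_iff by blast
    then have "\<exists>\<F>. finite \<F> \<and> \<F> \<subseteq> U ` K \<and> K \<subseteq> \<Union>\<F>"
      by (intro compactinD[OF K]) auto
    then obtain L where L: "finite L" "L \<subseteq> K" "K \<subseteq> \<Union>(U ` L)"
      by (metis finite_subset_image)
    then have "UNIV \<subseteq> (\<Union>l\<in>L. {n. s n \<in> U l})"
    proof (intro subsetI)
      fix n
      have "s n \<in> \<Union>(U ` L)"
        using s L(3) by blast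
      then show "n \<in> (\<Union>l\<in>L. {n. s n \<in> U l})"
        by blast
    qed
    moreover have "finite (\<Union>l\<in>L. {n. s n \<in> U l})"
      using L U by blast
    ultimately show False
      using finite_subset infinite_UNIV_nat by blast
  qed
  then show thesis
    using that by blast
qed

text \<open>If evaluation on a compact set \<open>K\<close> of functions failed to be equicontinuous at \<open>y\<close>, the open set of points
  that witness the failure would contain a sequence converging to \<open>y\<close>; that sequence together with
  its limit is compact, and a cluster point of the corresponding functions in \<open>C_k\<close> is
  not continuous along it.\<close>
lemma kappa_frechet_urysohn_equicontinuous:
  assumes FU: "kappa_frechet_urysohn Y" and K: "compactin (C_k Y) K" and y: "y \<in> topspace Y" and e: "e > 0"
  obtains V where "openin Y V" "y \<in> V" "\<And>f z. f \<in> K \<Longrightarrow> z \<in> V \<Longrightarrow> \<bar>f z - f y\<bar> \<le> e"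
proof -
  have K_sub: "K \<subseteq> topspace (C_k Y)"
    using K by (rule compactin_subset_topspace)
  define U where "U = (\<Union>f\<in>K. {z \<in> topspace Y. \<bar>f z - f y\<bar> \<in> {e<..}})"
  have "openin Y {z \<in> topspace Y. \<bar>f z - f y\<bar> \<in> {e<..}}" if "f \<in> K" for f
    using K_sub that
    by (intro openin_continuous_map_preimage[where Y = euclideanreal])
      (auto simp: topspace_C_k intro!: continuous_intros)
  then have U: "openin Y U"
    unfolding U_def by blast
  have "y \<notin> Y closure_of U"
  proof
    assume "y \<in> Y closure_of U"
    then obtain s where s: "range s \<subseteq> U" "limitin Y s y sequentially"
      using FU U unfolding kappa_frechet_urysohn_def by metis
    then have "\<forall>n. \<exists>f. f \<in> K \<and> e < \<bar>f (s n) - f y\<bar>"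
      unfolding U_def by (fastforce simp: image_subset_iff)
    then obtain g where g: "\<And>n. g n \<in> K" "\<And>n. e < \<bar>g n (s n) - g n y\<bar>"
      by metis
    obtain f where f: "f \<in> K" and cl: "\<And>W. openin (C_k Y) W \<Longrightarrow> f \<in> W \<Longrightarrow> infinite {n. g n \<in> W}"
      by (rule compactin_sequence_cluster[OF K, of g]) (use g in auto)
    have "openin Y {z \<in> topspace Y. f z \<in> ball (f y) (e/2)}"
      using f K_sub by (intro openin_continuous_map_preimage[where Y = euclideanreal]) (auto simp: topspace_C_k)
    then have "eventually (\<lambda>n. s n \<in> {z \<in> topspace Y. f z \<in> ball (f y) (e/2)}) sequentially"
      using s(2) y e by (intro limitinD) auto
    then obtain N where N: "\<And>n. n \<ge> N \<Longrightarrow> f (s n) \<in> ball (f y) (e/2)"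
      unfolding eventually_sequentially by blast
    \<comment> \<open>Cutting off the early terms makes \<open>f\<close> map \<open>L\<close> into
      the ball, so \<open>L\<close> defines a neighbourhood of \<open>f\<close> in
      \<open>C_k Y\<close>. A later \<open>g n\<close> in it has both \<open>g n (s n)\<close> and
      \<open>g n y\<close> within \<open>e/2\<close> of \<open>f y\<close>.\<close>
    define L where "L = insert y (s ` {N..})"
    have "compactin Y L"
      unfolding L_def using s U openin_subset by (intro compactin_sequence_with_limit[OF s(2)]) blast+
    then have "openin (C_k Y) {h \<in> topspace (C_k Y). h ` L \<subseteq> ball (f y) (e/2)}" (is "openin _ ?W")
      by (rule openin_C_k) auto
    moreover have "f \<in> ?W"
      using f K_sub N e by (auto simp: L_def)
    ultimately have "infinite {n. g n \<in> ?W}"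
      by (rule cl)
    then obtain n where "n \<ge> N" "g n \<in> ?W"
      unfolding infinite_nat_iff_unbounded_le by blast
    then have "g n (s n) \<in> ball (f y) (e/2)" "g n y \<in> ball (f y) (e/2)"
      using \<open>n \<ge> N\<close> by (auto simp: L_def image_subset_iff)
    then have "\<bar>g n (s n) - g n y\<bar> < e"
      unfolding ball_def dist_real_def mem_Collect_eq by linarith
    with g(2)[of n] show False
      by simp
  qed
  show thesis
  proof (rule that[of "topspace Y - Y closure_of U"])
    fix f z assume "f \<in> K" "z \<in> topspace Y - Y closure_of U"
    then have "z \<in> topspace Y" "z \<notin> U"
      using closure_of_subset[OF openin_subset[OF U]] by auto
    with \<open>f \<in> K\<close> show "\<bar>f z - f y\<bar> \<le> e"
      unfolding U_def by force
  qed (use y \<open>y \<notin> Y closure_of U\<close> in \<open>auto intro: openin_diff\<close>)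
qed

lemma kappa_frechet_urysohn_imp_ascoli:
  assumes FU: "kappa_frechet_urysohn Y"
  shows "ascoli_space Y"
  unfolding ascoli_space_def
proof (intro strip)
  fix K assume K: "compactin (C_k Y) K"
  have K_sub: "K \<subseteq> topspace (C_k Y)"
    using K by (rule compactin_subset_topspace)
  let ?P = "prod_topology (subtopology (C_k Y) K) Y"
  show "continuous_map ?P euclideanreal (\<lambda>(f, y). f y)"
    unfolding continuous_map_eq_topcontinuous_at
  proof
    fix p assume p: "p \<in> topspace ?P"
    obtain f y where fy: "p = (f, y)" "f \<in> K" "y \<in> topspace Y"
      using p by auto
    show "topcontinuous_at ?P euclideanreal (\<lambda>(f, y). f y) p"
    proof (rule topcontinuous_at_realI[OF p])
      fix e :: real assume e: "e > 0"
      obtain V where V: "openin Y V" "y \<in> V" "\<And>g z. g \<in> K \<Longrightarrow> z \<in> V \<Longrightarrow> \<bar>g z - g y\<bar> \<le> e/2"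
        by (rule kappa_frechet_urysohn_equicontinuous[OF FU K fy(3), of "e/2"]) (use e in auto)
      \<comment> \<open>One point is enough as compact set: \<open>V\<close> bounds the variation in
        the second argument for all members of \<open>K\<close> at once, using the other half of
        \<open>e\<close>.\<close>
      define W where "W = {g \<in> topspace (C_k Y). g ` {y} \<subseteq> ball (f y) (e/2)}"
      have "openin (C_k Y) W"
        unfolding W_def using fy by (intro openin_C_k finite_imp_compactin) auto
      then have "openin ?P ((W \<inter> K) \<times> V)"
        using V by (simp add: openin_prod_Times_iff openin_subtopology_Int)
      moreover have "p \<in> (W \<inter> K) \<times> V"
        using fy V K_sub e by (auto simp: W_def)
      moreover have "\<bar>(case q of (f, y) \<Rightarrow> f y) - (case p of (f, y) \<Rightarrow> f y)\<bar> < e"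
        if q: "q \<in> (W \<inter> K) \<times> V" for q
      proof -
        obtain g z where gz: "q = (g, z)" "g \<in> W" "g \<in> K" "z \<in> V"
          using q by (cases q) auto
        have "\<bar>g z - g y\<bar> \<le> e/2"
          using V(3) gz by blast
        moreover have "\<bar>g y - f y\<bar> < e/2"
          using gz(2) by (simp add: W_def dist_real_def abs_minus_commute)
        ultimately show ?thesis
          unfolding gz(1) fy(1) prod.case by linarith
      qed
      ultimately show "\<exists>U. openin ?P U \<and> p \<in> U \<and> (\<forall>q\<in>U. \<bar>(case q of (f, y) \<Rightarrow> f y) - (case p of (f, y) \<Rightarrow> f y)\<bar> < e)"
        by blast
    qed
  qed
qed

text \<open>Once \<open>\<Phi> n\<close> vanishes on a compact set it has the same image there as
  the zero function, so it enters every subbasic set around that function. Induction over the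
  generation of the topology passes this on to all open sets.\<close>

lemma limitin_C_k_zeroI:
  assumes \<Phi>: "\<And>n. \<Phi> n \<in> topspace (C_k Y)"
    and zero: "\<And>K. compactin Y K \<Longrightarrow> eventually (\<lambda>n. \<forall>y\<in>K. \<Phi> n y = 0) sequentially"
  shows "limitin (C_k Y) \<Phi> (restrict (\<lambda>_. 0) (topspace Y)) sequentially"
proof -
  define z :: "'a \<Rightarrow> real" where "z = restrict (\<lambda>_. 0) (topspace Y)"
  have z: "z \<in> topspace (C_k Y)"
    unfolding z_def topspace_C_k by (simp add: continuous_map_restrict_topspace)
  have "eventually (\<lambda>n. \<Phi> n \<in> W) sequentially" if "z \<in> W" "openin (C_k Y) W" for W
  proof -
    have "generate_topology_on {{f \<in> extensional (topspace Y). continuous_map Y euclideanreal f \<and> f ` K \<subseteq> U} | K U.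
        compactin Y K \<and> open U} W"
      using that(2) unfolding C_k_def by (rule openin_topology_generated_by)
    then show ?thesis
      using that(1)
    proof induction
      case (Int a b)
      then show ?case by (simp add: eventually_conj_iff)
    next
      case (UN \<W>)
      then obtain w where w: "w \<in> \<W>" "z \<in> w"
        by blast
      then have "eventually (\<lambda>n. \<Phi> n \<in> w) sequentially"
        by (rule UN.IH)
      then show ?case
        by (rule eventually_mono) (use w in blast)
    next
      case (Basis w)
      then obtain K U where w: "w = {f \<in> extensional (topspace Y). continuous_map Y euclideanreal f \<and> f ` K \<subseteq> U}"
          "compactin Y K"
        by blast
      have zK: "z y = 0" if "y \<in> K" for y
        using that compactin_subset_topspace[OF w(2)] by (auto simp: z_def)
      have "eventually (\<lambda>n. \<forall>y\<in>K. \<Phi> n y = 0) sequentially"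
        by (rule zero[OF w(2)])
      then show ?case
      proof (rule eventually_mono)
        fix n assume "\<forall>y\<in>K. \<Phi> n y = 0"
        then have "\<Phi> n ` K = z ` K"
          using zK by (intro image_cong) auto
        then show "\<Phi> n \<in> w"
          using Basis.prems \<Phi>[of n] unfolding w(1) topspace_C_k by auto
      qed
    qed simp
  qed
  then show ?thesis
    using z unfolding limitin_def z_def by blast
qed

text \<open>The functionals \<open>\<Phi> n\<close> vanish off \<open>{f. \<forall>x\<in>\<Delta> n. \<bar>f x\<bar> > n}\<close>. If no subsequence of \<open>\<Delta>\<close> is strongly
  point-finite, every compact set misses almost all of these sets, so \<open>\<Phi>\<close> converges to zero in
  \<open>C_k\<close>, although \<open>\<Phi> n\<close> takes the value \<open>1\<close> at functions arbitrarily close to the zero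
  function.\<close>
lemma ascoli_imp_property_kappa:
  assumes X: "tychonoff_space X" and A: "ascoli_space (C_p X)"
  shows "property_kappa X"
  unfolding property_kappa_def
proof (intro strip, rule ccontr)
  fix \<Delta> :: "nat \<Rightarrow> 'a set" assume dfs: "disjoint_finite_seq X \<Delta>"
    and no: "\<not> (\<exists>r :: nat \<Rightarrow> nat. strict_mono r \<and> strongly_point_finite X UNIV (\<Delta> \<circ> r))"
  have \<Delta>: "finite (\<Delta> n)" "\<Delta> n \<subseteq> topspace X" "disjoint_family \<Delta>" for n
    using dfs by (auto simp: disjoint_finite_seq_def)
  let ?Y = "C_p X"
  \<comment> \<open>The ramp makes each factor continuous, zero up to \<open>n\<close> and
    \<open>1\<close> from \<open>n + 1\<close> on; this is the origin of the value
    \<open>n + 1\<close> taken by the test function \<open>g\<close> below.\<close>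
  define \<Phi> where "\<Phi> n = (\<lambda>f\<in>topspace ?Y. \<Prod>x\<in>\<Delta> n. max 0 (min 1 (\<bar>f x\<bar> - real n)))" for n
  have \<Phi>: "\<Phi> n \<in> topspace (C_k ?Y)" for n
  proof -
    have "continuous_map ?Y euclideanreal (\<lambda>f. f x)" if "x \<in> topspace X" for x
      unfolding C_p_def using that by (intro continuous_intros) auto
    then have "continuous_map ?Y euclideanreal (\<lambda>f. \<Prod>x\<in>\<Delta> n. max 0 (min 1 (\<bar>f x\<bar> - real n)))"
      using \<Delta>(1,2)[of n] by (intro continuous_intros) auto
    then show ?thesis
      unfolding \<Phi>_def topspace_C_k by (simp add: continuous_map_restrict_topspace)
  qed
  have large: "real n < \<bar>f x\<bar>" if "f \<in> topspace ?Y" "\<Phi> n f \<noteq> 0" "x \<in> \<Delta> n" for n f x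
    using that \<Delta>(1)[of n] by (auto simp: \<Phi>_def prod_zero_iff max_def min_def split: if_splits)
  have "eventually (\<lambda>n. \<forall>f\<in>K. \<Phi> n f = 0) sequentially" if K: "compactin ?Y K" for K
  proof (rule ccontr)
    assume "\<not> ?thesis"
    then have "\<forall>N. \<exists>n f. n \<ge> N \<and> f \<in> K \<and> \<Phi> n f \<noteq> 0"
      unfolding eventually_sequentially by blast
    then obtain k h where kh: "\<And>N. k N \<ge> N" "\<And>N. h N \<in> K" "\<And>N. \<Phi> (k N) (h N) \<noteq> 0"
      by metis
    have hY: "h N \<in> topspace ?Y" for N
      using compactin_subset_topspace[OF K] kh(2) by blast
    have "\<exists>r :: nat \<Rightarrow> nat. strict_mono r \<and> strongly_point_finite X UNIV (\<Delta> \<circ> r)"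
    proof (rule strongly_point_finite_subseq_of_large[of X h \<Delta> k])
      show "continuous_map X euclideanreal (h N)" for N
        using hY by (simp add: topspace_C_p)
      show "real N < \<bar>h N x\<bar>" if "x \<in> \<Delta> (k N)" for N x
        using large[OF hY kh(3) that] kh(1)[of N] by linarith
      show "\<exists>M. \<forall>n. \<bar>h n x\<bar> \<le> M" if x: "x \<in> topspace X" for x
        using compactin_pointwise_bounded[OF K[unfolded C_p_eq_pointwise] x] kh(2) by metis
    qed (use kh \<Delta> in auto)
    with no show False by blast
  qed
  with \<Phi> have lim: "limitin (C_k ?Y) \<Phi> (restrict (\<lambda>_. 0) (topspace ?Y)) sequentially" (is "limitin _ _ ?z _")
    by (rule limitin_C_k_zeroI)
  define K where "K = insert ?z (range \<Phi>)"
  have "compactin (C_k ?Y) K"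
    unfolding K_def using \<Phi> by (intro compactin_sequence_with_limit[OF lim]) auto
  then have cont: "continuous_map (prod_topology (subtopology (C_k ?Y) K) ?Y) euclideanreal (\<lambda>(f, y). f y)"
    using A unfolding ascoli_space_def by blast
  define y where "y = restrict (\<lambda>_. 0 :: real) (topspace X)"
  have y: "y \<in> topspace ?Y"
    by (simp add: y_def topspace_C_p continuous_map_restrict_topspace)
  have z: "?z \<in> topspace (C_k ?Y)"
    using lim by (rule limitin_topspace)
  let ?P = "prod_topology (subtopology (C_k ?Y) K) ?Y"
  have "openin ?P {p \<in> topspace ?P. (case p of (f, y) \<Rightarrow> f y) \<in> {..<1}}"
    using cont by (intro openin_continuous_map_preimage[where Y = euclideanreal]) auto
  moreover have "(?z, y) \<in> {p \<in> topspace ?P. (case p of (f, y) \<Rightarrow> f y) \<in> {..<1}}"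
    using y z by (auto simp: K_def)
  \<comment> \<open>Evaluation is \<open>0\<close> at the limit pair, so it stays below
    \<open>1\<close> nearby. For large \<open>n\<close> this neighbourhood contains
    \<open>\<Phi> n\<close>, and a block disjoint from \<open>F\<close> allows a function in
    \<open>V\<close> at which \<open>\<Phi> n\<close> is \<open>1\<close>.\<close>
  ultimately obtain W V where WV: "openin (subtopology (C_k ?Y) K) W" "openin ?Y V" "?z \<in> W" "y \<in> V"
      "W \<times> V \<subseteq> {p \<in> topspace ?P. (case p of (f, y) \<Rightarrow> f y) \<in> {..<1}}"
    unfolding openin_prod_topology_alt by meson
  then obtain W' where W': "openin (C_k ?Y) W'" "W = W' \<inter> K"
    unfolding openin_subtopology by blast
  then have "eventually (\<lambda>n. \<Phi> n \<in> W') sequentially"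
    using WV(3) lim by (intro limitinD) auto
  then obtain N where N: "\<And>n. n \<ge> N \<Longrightarrow> \<Phi> n \<in> W"
    unfolding eventually_sequentially using W' by (auto simp: K_def)
  obtain F e where F: "finite F" "F \<subseteq> topspace X" "e > 0"
      and V: "\<And>g. g \<in> topspace ?Y \<Longrightarrow> (\<And>x. x \<in> F \<Longrightarrow> \<bar>g x - y x\<bar> < e) \<Longrightarrow> g \<in> V"
    using openin_pointwise_contains_box[OF WV(2,4)[unfolded C_p_eq_pointwise]] unfolding C_p_eq_pointwise by metis
  obtain n where n: "n \<ge> N" "\<Delta> n \<inter> F = {}"
    using disjoint_family_avoids_finite[OF \<Delta>(3) F(1)] by metis
  obtain g where g: "continuous_map X (top_of_set UNIV) g"
      "\<And>x. x \<in> \<Delta> n \<union> F \<Longrightarrow> g x = (if x \<in> \<Delta> n then real n + 1 else 0)"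
    by (rule tychonoff_finite_interpolation[OF X, of "\<Delta> n \<union> F" UNIV "\<lambda>x. if x \<in> \<Delta> n then real n + 1 else 0"])
      (use F \<Delta> in auto)
  let ?g = "restrict g (topspace X)"
  have gY: "?g \<in> topspace ?Y"
    using g(1) by (simp add: topspace_C_p continuous_map_restrict_topspace)
  have "?g \<in> V"
    using g(2) F n(2) by (intro V[OF gY]) (auto simp: y_def)
  then have "(\<Phi> n, ?g) \<in> W \<times> V"
    using N n by blast
  then have "\<Phi> n ?g < 1"
    using WV(5) by auto
  moreover have "\<Phi> n ?g = 1"
  proof -
    have "max 0 (min 1 (\<bar>?g x\<bar> - real n)) = 1" if "x \<in> \<Delta> n" for x
      using g(2)[of x] that \<Delta>(2)[of n] by auto
    then show ?thesis
      using gY by (simp add: \<Phi>_def)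
  qed
  ultimately show False by simp
qed

subsection \<open>The Banakh property\<close>

text \<open>\<open>A n\<close> omits the functions that exceed \<open>n\<close> in absolute value
  throughout some \<open>\<Delta> k\<close> with \<open>k \<ge> n\<close>; these are dense because
  some such block avoids any given finite set. A compact set contained in no \<open>A n\<close>
  yields functions that are large on blocks, yet pointwise bounded by compactness.\<close>

lemma not_banakh_imp_property_kappa:
  assumes X: "tychonoff_space X" and nB: "\<not> banakh_property (C_p X)"
  shows "property_kappa X"
  unfolding property_kappa_def
proof (intro strip, rule ccontr)
  fix \<Delta> :: "nat \<Rightarrow> 'a set" assume dfs: "disjoint_finite_seq X \<Delta>"
    and no: "\<not> (\<exists>r :: nat \<Rightarrow> nat. strict_mono r \<and> strongly_point_finite X UNIV (\<Delta> \<circ> r))"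
  have \<Delta>: "finite (\<Delta> n)" "\<Delta> n \<subseteq> topspace X" "disjoint_family \<Delta>" for n
    using dfs by (auto simp: disjoint_finite_seq_def)
  let ?Y = "C_p X"
  define G where "G k n = {f \<in> topspace ?Y. \<forall>x\<in>\<Delta> k. f x \<in> {t. real n < \<bar>t\<bar>}}" for k n
  define A where "A n = topspace ?Y - (\<Union>k\<in>{n..}. G k n)" for n
  have "open {t :: real. real n < \<bar>t\<bar>}" for n
    by (intro open_Collect_less continuous_intros)
  then have "openin ?Y (G k n)" for k n
    unfolding G_def C_p_eq_pointwise using \<Delta> by (intro openin_pointwise_finite) auto
  then have closed: "closedin ?Y (A n)" for n
    unfolding A_def by (intro closedin_diff) auto
  have "?Y interior_of (A n) = {}" for n
  proof (rule ccontr)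
    assume "?Y interior_of (A n) \<noteq> {}"
    then obtain f where f: "f \<in> ?Y interior_of (A n)"
      by blast
    obtain F e where F: "finite F" "F \<subseteq> topspace X" "e > 0"
        and V: "\<And>g. g \<in> topspace ?Y \<Longrightarrow> (\<And>x. x \<in> F \<Longrightarrow> \<bar>g x - f x\<bar> < e) \<Longrightarrow> g \<in> ?Y interior_of (A n)"
      using openin_pointwise_contains_box[OF openin_interior_of f[unfolded C_p_eq_pointwise]]
      unfolding C_p_eq_pointwise by metis
    obtain k where k: "k \<ge> n" "\<Delta> k \<inter> F = {}"
      using disjoint_family_avoids_finite[OF \<Delta>(3) F(1)] by metis
    obtain g where g: "continuous_map X (top_of_set UNIV) g"
        "\<And>x. x \<in> \<Delta> k \<union> F \<Longrightarrow> g x = (if x \<in> \<Delta> k then real n + 1 else f x)"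
      by (rule tychonoff_finite_interpolation[OF X, of "\<Delta> k \<union> F" UNIV "\<lambda>x. if x \<in> \<Delta> k then real n + 1 else f x"])
        (use F \<Delta> in auto)
    let ?g = "restrict g (topspace X)"
    have gY: "?g \<in> topspace ?Y"
      using g(1) by (simp add: topspace_C_p continuous_map_restrict_topspace)
    have "?g \<in> ?Y interior_of (A n)"
      using g(2) F k by (intro V[OF gY]) (auto simp: subset_iff)
    then have "?g \<in> A n"
      using interior_of_subset[of ?Y "A n"] by (rule subsetD[rotated])
    moreover have "?g \<in> G k n"
      using gY g(2) \<Delta>(2)[of k] by (auto simp: G_def subset_iff)
    ultimately show False
      using k(1) by (auto simp: A_def)
  qed
  then have "nowhere_dense_in ?Y (A n)" for n
    by (simp add: nowhere_dense_in_def closure_of_closedin[OF closed] closedin_subset[OF closed])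
  with closed have "\<forall>n. closedin ?Y (A n) \<and> nowhere_dense_in ?Y (A n)"
    by blast
  with nB have "\<not> (\<forall>K. compactin ?Y K \<longrightarrow> (\<exists>n. K \<subseteq> A n))"
    unfolding banakh_property_def by metis
  then obtain K where K: "compactin ?Y K" "\<And>n. \<not> K \<subseteq> A n"
    by blast
  have KY: "K \<subseteq> topspace ?Y"
    using K(1) by (rule compactin_subset_topspace)
  have "\<forall>n. \<exists>h k. h \<in> K \<and> k \<ge> n \<and> h \<in> G k n"
    using K(2) KY unfolding A_def by blast
  then obtain h k where hk: "\<And>n. h n \<in> K" "\<And>n. k n \<ge> n" "\<And>n. h n \<in> G (k n) n"
    by metis
  have "\<exists>r :: nat \<Rightarrow> nat. strict_mono r \<and> strongly_point_finite X UNIV (\<Delta> \<circ> r)"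
  proof (rule strongly_point_finite_subseq_of_large[of X h \<Delta> k])
    show "continuous_map X euclideanreal (h n)" for n
      using hk(1)[of n] KY by (auto simp: topspace_C_p)
    show "real n < \<bar>h n x\<bar>" if "x \<in> \<Delta> (k n)" for n x
      using hk(3)[of n] that by (auto simp: G_def)
    show "\<exists>M. \<forall>n. \<bar>h n x\<bar> \<le> M" if x: "x \<in> topspace X" for x
      using compactin_pointwise_bounded[OF K(1)[unfolded C_p_eq_pointwise] x] hk(1) by metis
  qed (use hk \<Delta> in auto)
  with no show False by blast
qed

text \<open>The condition \<open>f x > 1 / (m + 1)\<close> forces a sequence in \<open>U\<close> that converges to zero to leave every
  \<open>A m\<close>.\<close>
lemma kappa_frechet_urysohn_imp_not_banakh:
  assumes FU: "kappa_frechet_urysohn (C_p X)"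
  shows "\<not> banakh_property (C_p X)"
proof
  let ?Y = "C_p X"
  assume "banakh_property ?Y"
  then obtain B where B: "\<And>n. closedin ?Y (B n)" "\<And>n. nowhere_dense_in ?Y (B n)"
      "\<And>K. compactin ?Y K \<Longrightarrow> \<exists>n :: nat. K \<subseteq> B n"
    unfolding banakh_property_def by metis
  define y where "y = restrict (\<lambda>_. 0 :: real) (topspace X)"
  have y: "y \<in> topspace ?Y"
    by (simp add: y_def topspace_C_p continuous_map_restrict_topspace)
  \<comment> \<open>Finite unions of the closed sets \<open>B i\<close> stay nowhere dense and
    increase, so leaving \<open>A m\<close> means leaving every \<open>B i\<close> with
    \<open>i \<le> m\<close>.\<close>
  define A where "A m = (\<Union>i\<le>m. B i)" for m
  have A_closed: "closedin ?Y (A m)" for m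
    unfolding A_def using B(1) by (intro closedin_Union) auto
  have "?Y interior_of (A m) = {}" for m
  proof (induction m)
    case 0
    show ?case
      using B(1,2)[of 0] by (simp add: A_def nowhere_dense_in_def closure_of_closedin)
  next
    case (Suc m)
    have "A (Suc m) = A m \<union> B (Suc m)"
      by (auto simp: A_def atMost_Suc)
    then show ?case
      using Suc B(1,2)[of "Suc m"] A_closed[of m]
      by (simp add: interior_of_union_eq_empty nowhere_dense_in_def closure_of_closedin)
  qed
  then have A_empty: "T = {}" if "openin ?Y T" "T \<subseteq> A m" for T m
    using that unfolding interior_of_eq_empty by blast
  show False
  proof (cases "topspace X = {}")
    \<comment> \<open>Without points of \<open>X\<close> there is no coordinate to use, but
      \<open>C_p X\<close> is then a single point, which no nowhere dense set contains.\<close>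
    case True
    then have "topspace ?Y \<subseteq> {y}"
      by (auto simp: y_def topspace_C_p)
    moreover obtain n where "{y} \<subseteq> B n"
      using B(3)[of "{y}"] finite_imp_compactin[of "{y}" ?Y] y by auto
    moreover have "B n \<subseteq> A n"
      by (auto simp: A_def)
    ultimately show False
      using A_empty[OF openin_topspace[of ?Y], of n] y by blast
  next
    case False
    then obtain x where x: "x \<in> topspace X"
      by blast
    define V where "V m = {f \<in> topspace ?Y. f x \<in> {1 / real (Suc m)<..}}" for m
    have V: "openin ?Y (V m)" for m
      unfolding V_def C_p_eq_pointwise using x by (intro openin_pointwise_coordinate) auto
    define U where "U = (\<Union>m. V m - A m)"
    have "openin ?Y U"
      unfolding U_def using V A_closed by (intro openin_Union) auto
    moreover have "y \<in> ?Y closure_of U"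
      unfolding in_closure_of
    proof (intro conjI y strip)
      fix T assume T: "y \<in> T \<and> openin ?Y T"
      then obtain F e where e: "e > 0"
          and Te: "\<And>g. g \<in> topspace ?Y \<Longrightarrow> (\<And>x. x \<in> F \<Longrightarrow> \<bar>g x - y x\<bar> < e) \<Longrightarrow> g \<in> T"
          and F: "F \<subseteq> topspace X"
        using openin_pointwise_contains_box unfolding C_p_eq_pointwise by metis
      obtain m where m: "1 / real (Suc m) < e / 2"
        using reals_Archimedean[of "e/2"] e by (auto simp: inverse_eq_divide)
      \<comment> \<open>The constant \<open>e / 2\<close> lies in \<open>T\<close> and exceeds
        \<open>1 / (m + 1)\<close>, so \<open>T \<inter> V m\<close> is open and nonempty and cannot
        lie inside \<open>A m\<close>.\<close>
      define c where "c = restrict (\<lambda>_. e / 2) (topspace X)"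
      have c: "c \<in> topspace ?Y"
        by (simp add: c_def topspace_C_p continuous_map_restrict_topspace)
      have "c \<in> T"
        using F e by (intro Te[OF c]) (auto simp: c_def y_def subset_iff)
      moreover have "c \<in> V m"
        using c m x by (simp add: V_def c_def)
      ultimately have "\<not> T \<inter> V m \<subseteq> A m"
        using A_empty[of "T \<inter> V m" m] T V by blast
      then show "\<exists>g. g \<in> U \<and> g \<in> T"
        unfolding U_def by blast
    qed
    ultimately obtain s where s: "range s \<subseteq> U" "limitin ?Y s y sequentially"
      using FU unfolding kappa_frechet_urysohn_def by metis
    have "compactin ?Y (insert y (range s))"
      using s(1) openin_subset[OF \<open>openin ?Y U\<close>] by (intro compactin_sequence_with_limit[OF s(2)]) auto
    then obtain i where i: "insert y (range s) \<subseteq> B i"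
      using B(3) by blast
    have "(\<lambda>j. s j x) \<longlonglongrightarrow> 0"
      using s(2) x by (auto simp: C_p_eq_pointwise limitin_pointwise y_def)
    then have "eventually (\<lambda>j. s j x < 1 / real (Suc i)) sequentially"
      by (rule order_tendstoD) simp
    then obtain j where j: "s j x < 1 / real (Suc i)"
      unfolding eventually_sequentially by blast
    have "s j \<in> U"
      using s(1) by blast
    then obtain m where m: "s j \<in> V m" "s j \<notin> A m"
      unfolding U_def by blast
    \<comment> \<open>The value \<open>s j x\<close> lies strictly between the two fractions. Hence
      \<open>B i \<subseteq> A m\<close>, although \<open>s j\<close> belongs to \<open>B i\<close>
      and not to \<open>A m\<close>.\<close>
    have "1 / real (Suc m) < 1 / real (Suc i)"
      using m(1) j by (auto simp: V_def)
    then have "i \<le> m"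
      by (simp add: field_simps)
    then show False
      using m(2) i by (auto simp: A_def)
  qed
qed

subsection \<open>Strongly \<open>Coz\<^sub>\<delta>\<close>-disjoint subsequences\<close>

lemma cozero_set_iff:
  "cozero_set X W \<longleftrightarrow> (\<exists>f. continuous_map X euclideanreal f \<and> W = {x \<in> topspace X. f x \<noteq> 0})"
proof -
  have "topspace X - {x \<in> topspace X. f x = 0} = {x \<in> topspace X. f x \<noteq> 0}" for f :: "'a \<Rightarrow> real"
    by auto
  then show ?thesis
    unfolding cozero_set_def zero_set_def by auto
qed

lemma cozero_set_openin: "cozero_set X W \<Longrightarrow> openin X W"
  unfolding cozero_set_def zero_set_def
  using closedin_continuous_map_preimage[of X euclideanreal _ "{0}"] by fastforce

lemma cozero_set_Int:
  assumes "cozero_set X V" "cozero_set X W"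
  shows "cozero_set X (V \<inter> W)"
proof -
  obtain f g where fg: "continuous_map X euclideanreal f" "V = {x \<in> topspace X. f x \<noteq> 0}"
      "continuous_map X euclideanreal g" "W = {x \<in> topspace X. g x \<noteq> 0}"
    using assms unfolding cozero_set_iff by blast
  then show ?thesis
    unfolding cozero_set_iff by (intro exI[of _ "\<lambda>x. f x * g x"]) (auto intro: continuous_map_real_mult)
qed

lemma cozero_set_finite_INT:
  assumes "finite I" "\<And>i. i \<in> I \<Longrightarrow> cozero_set X (W i)"
  shows "cozero_set X {x \<in> topspace X. \<forall>i\<in>I. x \<in> W i}"
  using assms
proof (induction I)
  case empty
  show ?case
    unfolding cozero_set_iff by (rule exI[of _ "\<lambda>_. 1"]) auto
next
  case (insert i I)
  have "{x \<in> topspace X. \<forall>i\<in>insert i I. x \<in> W i} = W i \<inter> {x \<in> topspace X. \<forall>i\<in>I. x \<in> W i}"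
    using cozero_set_openin[of X "W i"] openin_subset insert.prems by auto
  then show ?case
    using insert by (simp add: cozero_set_Int)
qed

lemma cozero_set_UN_nat:
  assumes "\<And>n :: nat. cozero_set X (W n)"
  shows "cozero_set X (\<Union>n. W n)"
proof -
  obtain f where f: "\<And>n. continuous_map X euclideanreal (f n)" "\<And>n. W n = {x \<in> topspace X. f n x \<noteq> 0}"
    using assms unfolding cozero_set_iff by metis
  \<comment> \<open>Truncation and weights give a geometric majorant, hence a continuous sum; its
    nonnegative terms add up to zero only where all \<open>f n\<close> vanish.\<close>
  define h where "h n x = (1/2) ^ n * min 1 \<bar>f n x\<bar>" for n x
  have h: "0 \<le> h n x" "h n x \<le> (1/2) ^ n" for n x
    by (auto simp: h_def mult_le_one)
  have sm: "summable (\<lambda>n. h n x)" for x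
    by (rule summable_comparison_test[of _ "\<lambda>n. (1/2) ^ n"]) (use h in \<open>auto simp: summable_geometric\<close>)
  have unif: "uniform_limit UNIV (\<lambda>n x. \<Sum>i<n. h i x) (\<lambda>x. \<Sum>i. h i x) sequentially"
    by (rule Weierstrass_m_test[of _ _ "\<lambda>n. (1/2) ^ n"]) (use h in \<open>auto simp: summable_geometric\<close>)
  have "continuous_map X Met_TC.mtopology (\<lambda>x. \<Sum>i. h i x)"
  proof (intro Met_TC.continuous_map_uniform_limit[where F = sequentially and f = "\<lambda>n x. \<Sum>i<n. h i x"])
    show "\<forall>\<^sub>F n in sequentially. continuous_map X Met_TC.mtopology (\<lambda>x. \<Sum>i<n. h i x)"
      unfolding h_def mtopology_is_euclidean by (intro always_eventually allI continuous_intros f) auto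
    show "\<forall>\<^sub>F n in sequentially. \<forall>x\<in>topspace X. (\<Sum>i. h i x) \<in> UNIV \<and> dist (\<Sum>i<n. h i x) (\<Sum>i. h i x) < e"
      if "e > 0" for e
      using uniform_limitD[OF unif that] by (rule eventually_mono) simp
  qed simp_all
  then have "continuous_map X euclideanreal (\<lambda>x. \<Sum>i. h i x)"
    by simp
  moreover have "(\<Sum>i. h i x) \<noteq> 0 \<longleftrightarrow> (\<exists>n. f n x \<noteq> 0)" for x
    using suminf_eq_zero_iff[OF sm] h by (auto simp: h_def min_def)
  ultimately show ?thesis
    unfolding cozero_set_iff by (intro exI[of _ "\<lambda>x. \<Sum>i. h i x"]) (auto simp: f(2))
qed

lemma cozero_set_UN_countable:
  assumes "countable B" "\<And>b. b \<in> B \<Longrightarrow> cozero_set X (W b)"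
  shows "cozero_set X (\<Union>b\<in>B. W b)"
proof (cases "B = {}")
  case True
  then show ?thesis
    unfolding cozero_set_iff by (intro exI[of _ "\<lambda>_. 0"]) auto
next
  case False
  have "(\<Union>b\<in>B. W b) = (\<Union>n. W (from_nat_into B n))"
    using range_from_nat_into[OF False assms(1)] by (metis image_image)
  then show ?thesis
    using cozero_set_UN_nat[of X "\<lambda>n. W (from_nat_into B n)"] assms(2) from_nat_into[OF False] by simp
qed

section \<open>Passing between \<open>coz_delta\<close> neighbourhoods and point-finite open
  families\<close>

lemma coz_delta_imp_gdelta_sequence:
  assumes "coz_delta X G"
  obtains W :: "nat \<Rightarrow> 'a set" where "\<And>n. openin X (W n)" "G = (\<Inter>n. W n)"
  using assms cozero_set_openin unfolding coz_delta_def by metis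

text \<open>The unions \<open>T i\<close> of the neighbourhoods belonging to blocks from
  \<open>i\<close> on are countable intersections of open sets, and disjointness makes their common
  intersection empty. The diagonal intersections \<open>U n\<close> contain the \<open>n\<close>-th
  block, and a point in infinitely many of them would lie in every \<open>T i\<close>.\<close>

lemma coz_delta_subsequences_imp_property_kappa:
  assumes coz: "\<And>\<Delta> :: nat \<Rightarrow> 'a set. disjoint_finite_seq X \<Delta> \<Longrightarrow> (\<And>n. \<Delta> n \<noteq> {}) \<Longrightarrow>
    \<exists>r :: nat \<Rightarrow> nat. strict_mono r \<and> strongly_coz_delta_disjoint_seq X (\<Delta> \<circ> r)"
  shows "property_kappa X"
proof (rule property_kappaI_nonempty)
  fix \<Delta> :: "nat \<Rightarrow> 'a set" assume dfs: "disjoint_finite_seq X \<Delta>" and ne: "\<And>n. \<Delta> n \<noteq> {}"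
  obtain r :: "nat \<Rightarrow> nat" where r: "strict_mono r" "strongly_coz_delta_disjoint_seq X (\<Delta> \<circ> r)"
    using coz[OF dfs ne] by blast
  define \<Delta>' where "\<Delta>' = \<Delta> \<circ> r"
  have dj: "disjoint_family \<Delta>'" and sub: "\<Delta>' n \<subseteq> topspace X" for n
    using r(2) by (auto simp: strongly_coz_delta_disjoint_seq_def disjoint_finite_seq_def \<Delta>'_def)
  define A where "A = (\<Union>n. \<Delta>' n)"
  obtain F where F: "\<And>a. a \<in> A \<Longrightarrow> a \<in> F a" "disjoint_family_on F A"
      "\<And>B. B \<subseteq> A \<Longrightarrow> coz_delta X (\<Union>b\<in>B. F b)"
    using r(2) unfolding strongly_coz_delta_disjoint_seq_def strongly_coz_delta_disjoint_def A_def \<Delta>'_def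
    by metis
  define T where "T i = (\<Union>b\<in>(\<Union>m\<in>{i..}. \<Delta>' m). F b)" for i
  have "\<exists>W :: nat \<Rightarrow> 'a set. (\<forall>n. openin X (W n)) \<and> T i = (\<Inter>n. W n)" for i
  proof -
    have "coz_delta X (T i)"
      unfolding T_def by (rule F(3)) (auto simp: A_def)
    then show ?thesis
      by (metis coz_delta_imp_gdelta_sequence)
  qed
  then obtain W where W: "\<And>i n :: nat. openin X (W i n)" "\<And>i. T i = (\<Inter>n. W i n)"
    by metis
  define U where "U n = (\<Inter>i\<in>{..n}. \<Inter>j\<in>{..n}. W i j)" for n
  have U: "openin X (U n)" for n
    unfolding U_def using W by (intro openin_INT2) auto
  have \<Delta>U: "\<Delta>' n \<subseteq> U n" for n
  proof -
    have "\<Delta>' n \<subseteq> T i" if "i \<le> n" for i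
      using that F(1) by (auto simp: T_def A_def)
    then show ?thesis
      unfolding U_def W(2) by blast
  qed
  have "(\<Inter>i. T i) = {}"
  proof (rule ccontr)
    assume "(\<Inter>i. T i) \<noteq> {}"
    then obtain x where x: "\<And>i. x \<in> T i"
      by blast
    obtain a m where am: "a \<in> \<Delta>' m" "x \<in> F a"
      using x[of 0] by (auto simp: T_def)
    obtain b m' where bm: "b \<in> \<Delta>' m'" "x \<in> F b" "m' \<ge> Suc m"
      using x[of "Suc m"] by (auto simp: T_def)
    have "a \<in> A" "b \<in> A"
      using am bm by (auto simp: A_def)
    then have "a = b"
      using F(2) am(2) bm(2) unfolding disjoint_family_on_def by blast
    then have "a \<in> \<Delta>' m \<inter> \<Delta>' m'"
      using am(1) bm(1) by blast
    then show False
      using dj bm(3) unfolding disjoint_family_on_def by (metis UNIV_I empty_iff not_less_eq_eq order_refl)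
  qed
  moreover have "x \<in> (\<Inter>i. T i)" if inf: "infinite {n. x \<in> U n}" for x
  proof -
    have "x \<in> W i j" for i j
    proof -
      obtain n where "n \<ge> max i j" "x \<in> U n"
        using inf unfolding infinite_nat_iff_unbounded_le by blast
      then show ?thesis
        by (auto simp: U_def)
    qed
    then show ?thesis
      by (simp add: W(2))
  qed
  ultimately have "point_finite (topspace X) UNIV U"
    unfolding point_finite_def by auto
  then have "strongly_point_finite X UNIV \<Delta>'"
    unfolding strongly_point_finite_def using U \<Delta>U by blast
  then show "\<exists>r :: nat \<Rightarrow> nat. strict_mono r \<and> strongly_point_finite X UNIV (\<Delta> \<circ> r)"
    using r(1) unfolding \<Delta>'_def by blast
qed

text \<open>There is one bump for each point instead of each block; since blocks are finite, the
  family stays point-finite. Both the \<open>coz_delta\<close> sets and the Baire-one interpolation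
  are built from these bumps.\<close>

lemma property_kappa_bump_functions:
  assumes X: "tychonoff_space X" and \<kappa>: "property_kappa X" and dfs: "disjoint_finite_seq X \<Delta>"
  obtains r :: "nat \<Rightarrow> nat" and \<phi> :: "'a \<Rightarrow> 'a \<Rightarrow> real" where "strict_mono r"
    "\<And>a. a \<in> (\<Union>n. \<Delta> (r n)) \<Longrightarrow> continuous_map X euclideanreal (\<phi> a)"
    "\<And>a. a \<in> (\<Union>n. \<Delta> (r n)) \<Longrightarrow> \<phi> a a = 1"
    "\<And>x. x \<in> topspace X \<Longrightarrow> finite {a \<in> (\<Union>n. \<Delta> (r n)). \<phi> a x \<noteq> 0}"
proof -
  obtain r :: "nat \<Rightarrow> nat" where r: "strict_mono r" "strongly_point_finite X UNIV (\<Delta> \<circ> r)"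
    using \<kappa> dfs unfolding property_kappa_def by metis
  then obtain V where V: "\<And>i. openin X (V i)" "\<And>i. \<Delta> (r i) \<subseteq> V i" "point_finite (topspace X) UNIV V"
    unfolding strongly_point_finite_def by auto
  let ?A = "\<Union>n. \<Delta> (r n)"
  have "\<exists>\<phi> :: 'a \<Rightarrow> real. continuous_map X euclideanreal \<phi> \<and> \<phi> a = 1 \<and>
      (\<exists>n. a \<in> \<Delta> (r n) \<and> (\<forall>x\<in>topspace X - V n. \<phi> x = 0))" if a: "a \<in> ?A" for a
  proof -
    obtain n where n: "a \<in> \<Delta> (r n)"
      using a by blast
    show ?thesis
      by (rule tychonoff_bump[OF X _ _ V(1)[of n], of "{a}"]) (use n V(2) in blast)+
  qed
  then have "\<forall>a\<in>?A. \<exists>\<phi> :: 'a \<Rightarrow> real. continuous_map X euclideanreal \<phi> \<and> \<phi> a = 1 \<and>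
      (\<exists>n. a \<in> \<Delta> (r n) \<and> (\<forall>x\<in>topspace X - V n. \<phi> x = 0))"
    by blast
  then obtain \<phi> :: "'a \<Rightarrow> 'a \<Rightarrow> real" where \<phi>: "\<And>a. a \<in> ?A \<Longrightarrow> continuous_map X euclideanreal (\<phi> a) \<and> \<phi> a a = 1 \<and>
      (\<exists>n. a \<in> \<Delta> (r n) \<and> (\<forall>x\<in>topspace X - V n. \<phi> a x = 0))"
    unfolding bchoice_iff by blast
  have "finite {a \<in> ?A. \<phi> a x \<noteq> 0}" if x: "x \<in> topspace X" for x
  proof -
    have "{a \<in> ?A. \<phi> a x \<noteq> 0} \<subseteq> (\<Union>n\<in>{n. x \<in> V n}. \<Delta> (r n))"
      using \<phi> x by blast
    moreover have "finite {n. x \<in> V n}"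
      using V(3) x by (simp add: point_finite_def)
    ultimately show ?thesis
      using dfs finite_subset unfolding disjoint_finite_seq_def by blast
  qed
  then show thesis
    using r(1) \<phi> that by blast
qed

lemma tychonoff_separating_functions:
  assumes X: "tychonoff_space X"
  obtains \<psi> :: "'a \<Rightarrow> 'a \<Rightarrow> 'a \<Rightarrow> real" where
    "\<And>a b. a \<in> topspace X \<Longrightarrow> b \<in> topspace X \<Longrightarrow> a \<noteq> b \<Longrightarrow> continuous_map X euclideanreal (\<psi> a b)"
    "\<And>a b x. a \<in> topspace X \<Longrightarrow> b \<in> topspace X \<Longrightarrow> a \<noteq> b \<Longrightarrow> x \<in> topspace X \<Longrightarrow> 0 \<le> \<psi> a b x \<and> \<psi> a b x \<le> 1"
    "\<And>a b. a \<in> topspace X \<Longrightarrow> b \<in> topspace X \<Longrightarrow> a \<noteq> b \<Longrightarrow> \<psi> a b a = 1 \<and> \<psi> a b b = 0"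
proof -
  have "\<exists>\<psi> :: 'a \<Rightarrow> real. a \<in> topspace X \<longrightarrow> b \<in> topspace X \<longrightarrow> a \<noteq> b \<longrightarrow> continuous_map X euclideanreal \<psi> \<and>
      (\<forall>x\<in>topspace X. 0 \<le> \<psi> x \<and> \<psi> x \<le> 1) \<and> \<psi> a = 1 \<and> \<psi> b = 0" for a b
  proof (cases "a \<in> topspace X \<and> b \<in> topspace X \<and> a \<noteq> b")
    case True
    have "openin X (topspace X - {b})"
      using tychonoff_finite_closedin[OF X, of "{b}"] True by blast
    then show ?thesis
      by (rule tychonoff_bump[OF X, of "{a}", rotated 2]) (use True in auto)
  qed blast
  then obtain \<psi> :: "'a \<Rightarrow> 'a \<Rightarrow> 'a \<Rightarrow> real" where
    "\<And>a b. a \<in> topspace X \<longrightarrow> b \<in> topspace X \<longrightarrow> a \<noteq> b \<longrightarrow> continuous_map X euclideanreal (\<psi> a b) \<and>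
      (\<forall>x\<in>topspace X. 0 \<le> \<psi> a b x \<and> \<psi> a b x \<le> 1) \<and> \<psi> a b a = 1 \<and> \<psi> a b b = 0"
    by metis
  then show thesis
    by (intro that[of \<psi>]) blast+
qed

text \<open>The neighbourhoods \<open>W a j\<close> of \<open>a\<close> decrease with \<open>j\<close> inside a point-finite family, so unions over \<open>a\<close>
  commute with the intersection over \<open>j\<close>.\<close>
lemma property_kappa_imp_coz_delta_subsequence:
  assumes X: "tychonoff_space X" and \<kappa>: "property_kappa X" and dfs: "disjoint_finite_seq X \<Delta>"
  shows "\<exists>r :: nat \<Rightarrow> nat. strict_mono r \<and> strongly_coz_delta_disjoint_seq X (\<Delta> \<circ> r)"
proof -
  obtain r :: "nat \<Rightarrow> nat" and \<phi> :: "'a \<Rightarrow> 'a \<Rightarrow> real" where r: "strict_mono r"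
      and "\<And>a. a \<in> (\<Union>n. \<Delta> (r n)) \<Longrightarrow> continuous_map X euclideanreal (\<phi> a)"
      and "\<And>a. a \<in> (\<Union>n. \<Delta> (r n)) \<Longrightarrow> \<phi> a a = 1"
      and "\<And>x. x \<in> topspace X \<Longrightarrow> finite {a \<in> (\<Union>n. \<Delta> (r n)). \<phi> a x \<noteq> 0}"
    by (rule property_kappa_bump_functions[OF X \<kappa> dfs]) blast
  moreover define A where "A = (\<Union>n. \<Delta> (r n))"
  ultimately have \<phi>: "\<And>a. a \<in> A \<Longrightarrow> continuous_map X euclideanreal (\<phi> a)" "\<And>a. a \<in> A \<Longrightarrow> \<phi> a a = 1"
      "\<And>x. x \<in> topspace X \<Longrightarrow> finite {a \<in> A. \<phi> a x \<noteq> 0}"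
    by simp_all
  have \<Delta>: "finite (\<Delta> n)" "\<Delta> n \<subseteq> topspace X" "disjoint_family \<Delta>" for n
    using dfs by (auto simp: disjoint_finite_seq_def)
  have A: "A \<subseteq> topspace X" "countable A"
    using \<Delta> unfolding A_def by (auto intro: countable_finite)
  define e where "e = to_nat_on A"
  have e: "inj_on e A"
    using A(2) by (simp add: e_def inj_on_to_nat_on)
  obtain \<psi> :: "'a \<Rightarrow> 'a \<Rightarrow> 'a \<Rightarrow> real" where
    \<psi>: "\<And>a b. a \<in> topspace X \<Longrightarrow> b \<in> topspace X \<Longrightarrow> a \<noteq> b \<Longrightarrow> continuous_map X euclideanreal (\<psi> a b)"
      "\<And>a b. a \<in> topspace X \<Longrightarrow> b \<in> topspace X \<Longrightarrow> a \<noteq> b \<Longrightarrow> \<psi> a b a = 1 \<and> \<psi> a b b = 0"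
    using tychonoff_separating_functions[OF X] by metis
  \<comment> \<open>\<open>N a b\<close> is the set where \<open>\<psi> a b\<close> exceeds
    \<open>\<psi> b a\<close>; the strict comparison makes \<open>N a b\<close> and
    \<open>N b a\<close> disjoint even if the two functions have overlapping supports.\<close>
  define N where "N a b = {x \<in> topspace X. max 0 (\<psi> a b x - \<psi> b a x) \<noteq> 0}" for a b
  have N: "cozero_set X (N a b)" "a \<in> N a b" "N a b \<inter> N b a = {}" if "a \<in> A" "b \<in> A" "a \<noteq> b" for a b
  proof -
    show "cozero_set X (N a b)"
      unfolding cozero_set_iff N_def using that A
      by (intro exI[of _ "\<lambda>x. max 0 (\<psi> a b x - \<psi> b a x)"] conjI refl continuous_intros \<psi>) auto
    show "a \<in> N a b"
    proof -
      have "a \<in> topspace X" "b \<in> topspace X"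
        using that A by auto
      then show ?thesis
        using \<psi>(2)[of a b] \<psi>(2)[of b a] that(3) by (simp add: N_def)
    qed
    show "N a b \<inter> N b a = {}"
      by (auto simp: N_def)
  qed
  \<comment> \<open>At level \<open>j\<close> only the finitely many \<open>b\<close> with
    \<open>e b \<le> j\<close> are separated from \<open>a\<close>, which keeps \<open>W a j\<close>
    a cozero set; the intersection \<open>F a\<close> separates all of them.\<close>
  define W where "W a j = {x \<in> topspace X. \<phi> a x \<noteq> 0} \<inter>
      {x \<in> topspace X. \<forall>b\<in>{b \<in> A. e b \<le> j \<and> b \<noteq> a}. x \<in> N a b}" for a j
  define F where "F a = (\<Inter>j. W a j)" for a
  have fin: "finite {b \<in> A. e b \<le> j \<and> b \<noteq> a}" for a j
  proof -
    have "finite {b \<in> A. e b \<le> j}"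
      using finite_vimage_IntI[OF finite_atMost[of j] e] by (simp add: vimage_def Int_def conj_commute)
    then show ?thesis
      by (rule finite_subset[rotated]) auto
  qed
  have W: "cozero_set X (W a j)" if "a \<in> A" for a j
  proof -
    have "cozero_set X {x \<in> topspace X. \<phi> a x \<noteq> 0}"
      unfolding cozero_set_iff using \<phi>(1) that by blast
    moreover have "cozero_set X {x \<in> topspace X. \<forall>b\<in>{b \<in> A. e b \<le> j \<and> b \<noteq> a}. x \<in> N a b}"
      using that by (intro cozero_set_finite_INT fin N) auto
    ultimately show ?thesis
      unfolding W_def by (rule cozero_set_Int)
  qed
  have W_mono: "W a j \<subseteq> W a i" if "i \<le> j" for a i j
    using that by (auto simp: W_def)
  have aF: "a \<in> F a" if "a \<in> A" for a
    using that A N(2) \<phi>(2) by (auto simp: F_def W_def)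
  have "disjoint_family_on F A"
    unfolding disjoint_family_on_def
  proof (intro ballI impI)
    fix a b assume ab: "a \<in> A" "b \<in> A" "a \<noteq> b"
    have "F a \<subseteq> W a (e b)" "F b \<subseteq> W b (e a)"
      by (auto simp: F_def)
    then have "F a \<subseteq> N a b" "F b \<subseteq> N b a"
      using ab by (auto simp: W_def)
    then show "F a \<inter> F b = {}"
      using N(3)[OF ab] by blast
  qed
  moreover have "coz_delta X (\<Union>b\<in>B. F b)" if B: "B \<subseteq> A" for B
  proof -
    have "(\<Union>b\<in>B. F b) = (\<Inter>j. \<Union>b\<in>B. W b j)"
    proof (intro equalityI subsetI)
      fix x assume "x \<in> (\<Inter>j. \<Union>b\<in>B. W b j)"
      then have "\<forall>j. \<exists>b\<in>B. x \<in> W b j"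
        by blast
      then obtain p where p: "\<And>j. p j \<in> B" "\<And>j. x \<in> W (p j) j"
        by metis
      have "range p \<subseteq> {a \<in> A. \<phi> a x \<noteq> 0}" "x \<in> topspace X"
        using p B by (auto simp: W_def)
      \<comment> \<open>Finitely many candidates mean that one of them recurs for arbitrarily large
        \<open>j\<close>, and monotonicity then fills in the remaining levels.\<close>
      then have "finite (range p)"
        using \<phi>(3) finite_subset by blast
      then obtain i where i: "infinite {j. p j = p i}"
        using pigeonhole_infinite[of UNIV p] by auto
      have "x \<in> W (p i) j" for j
      proof -
        obtain l where "l \<ge> j" "p l = p i"
          using i unfolding infinite_nat_iff_unbounded_le by blast
        then show ?thesis
          using p(2)[of l] W_mono[of j l] by auto
      qed
      then show "x \<in> (\<Union>b\<in>B. F b)"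
        using p(1) by (auto simp: F_def)
    qed (auto simp: F_def)
    moreover have "cozero_set X (\<Union>b\<in>B. W b j)" for j
      using B W A countable_subset by (intro cozero_set_UN_countable) blast+
    ultimately show ?thesis
      unfolding coz_delta_def by (intro exI[of _ "\<lambda>j. \<Union>b\<in>B. W b j"]) simp
  qed
  moreover have "coz_delta X (F a)" if "a \<in> A" for a
    unfolding coz_delta_def F_def using W[OF that] by (intro exI[of _ "W a"]) simp
  ultimately have "strongly_coz_delta_disjoint X A"
    unfolding strongly_coz_delta_disjoint_def using aF by (intro exI[of _ F]) simp
  moreover have "disjoint_finite_seq X (\<Delta> \<circ> r)"
    using \<Delta> strict_mono_eq[OF r] by (auto simp: disjoint_finite_seq_def disjoint_family_on_def)
  ultimately show ?thesis
    using r unfolding strongly_coz_delta_disjoint_seq_def A_def by auto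
qed

subsection \<open>Baire-one functions\<close>

lemma continuous_imp_baire_one: "continuous_map X euclideanreal f \<Longrightarrow> baire_one X f"
  unfolding baire_one_def by (intro exI[of _ "\<lambda>_. f"]) auto

lemma baire_one_cong:
  "baire_one X f \<Longrightarrow> (\<And>x. x \<in> topspace X \<Longrightarrow> f x = g x) \<Longrightarrow> baire_one X g"
  unfolding baire_one_def by auto

lemma baire_one_add:
  assumes "baire_one X f" "baire_one X g"
  shows "baire_one X (\<lambda>x. f x + g x)"
proof -
  obtain a b where "\<And>n :: nat. continuous_map X euclideanreal (a n)" "\<And>x. x \<in> topspace X \<Longrightarrow> (\<lambda>n. a n x) \<longlonglongrightarrow> f x"
      "\<And>n :: nat. continuous_map X euclideanreal (b n)" "\<And>x. x \<in> topspace X \<Longrightarrow> (\<lambda>n. b n x) \<longlonglongrightarrow> g x"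
    using assms unfolding baire_one_def by metis
  then show ?thesis
    unfolding baire_one_def
    by (intro exI[of _ "\<lambda>n x. a n x + b n x"]) (auto intro!: continuous_map_add tendsto_add)
qed

lemma topspace_B_1: "f \<in> topspace (B_1 X) \<longleftrightarrow> f \<in> extensional (topspace X) \<and> baire_one X f"
  by (simp add: B_1_eq_pointwise topspace_pointwise)

lemma baire_one_restrict: "baire_one X f \<Longrightarrow> restrict f (topspace X) \<in> topspace (B_1 X)"
  by (auto simp: topspace_B_1 intro: baire_one_cong)

text \<open>A function \<open>f\<close> in all \<open>D n\<close> is large on blocks, but the sets
  where it is large need not be open. Since a block is finite, a single continuous approximant of
  \<open>f\<close> is large on all of it, and the approximants are pointwise bounded because they
  converge pointwise.\<close>

lemma baire_B_1_imp_property_kappa: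
  assumes X: "tychonoff_space X" and B: "baire_space (B_1 X)"
  shows "property_kappa X"
  unfolding property_kappa_def
proof (intro strip)
  fix \<Delta> :: "nat \<Rightarrow> 'a set" assume dfs: "disjoint_finite_seq X \<Delta>"
  have \<Delta>: "finite (\<Delta> n)" "\<Delta> n \<subseteq> topspace X" "disjoint_family \<Delta>" for n
    using dfs by (auto simp: disjoint_finite_seq_def)
  let ?Y = "B_1 X"
  define G where "G k n = {f \<in> topspace ?Y. \<forall>x\<in>\<Delta> k. f x \<in> {t. real n < \<bar>t\<bar>}}" for k n
  define D where "D n = (\<Union>k\<in>{n..}. G k n)" for n
  have op: "open {t :: real. real n < \<bar>t\<bar>}" for n
    by (intro open_Collect_less continuous_intros)
  then have "openin ?Y (G k n)" for k n
    unfolding G_def B_1_eq_pointwise using \<Delta> by (intro openin_pointwise_finite) auto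
  then have D_open: "openin ?Y (D n)" for n
    unfolding D_def by (intro openin_Union) auto
  have D_dense: "?Y closure_of (D n) = topspace ?Y" for n
    unfolding dense_intersects_open
  proof (intro strip)
    fix T assume T: "openin ?Y T \<and> T \<noteq> {}"
    then obtain f where f: "f \<in> T"
      by blast
    obtain F e where F: "finite F" "F \<subseteq> topspace X" "e > 0"
        and V: "\<And>g. g \<in> topspace ?Y \<Longrightarrow> (\<And>x. x \<in> F \<Longrightarrow> \<bar>g x - f x\<bar> < e) \<Longrightarrow> g \<in> T"
      using openin_pointwise_contains_box[OF conjunct1[OF T, unfolded B_1_eq_pointwise] f]
      unfolding B_1_eq_pointwise by metis
    obtain k where k: "k \<ge> n" "\<Delta> k \<inter> F = {}"
      using disjoint_family_avoids_finite[OF \<Delta>(3) F(1)] by metis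
    obtain g where g: "continuous_map X (top_of_set UNIV) g"
        "\<And>x. x \<in> \<Delta> k \<union> F \<Longrightarrow> g x = (if x \<in> \<Delta> k then real n + 1 else f x)"
      by (rule tychonoff_finite_interpolation[OF X, of "\<Delta> k \<union> F" UNIV "\<lambda>x. if x \<in> \<Delta> k then real n + 1 else f x"])
        (use F \<Delta> in auto)
    let ?g = "restrict g (topspace X)"
    have gY: "?g \<in> topspace ?Y"
      using g(1) by (intro baire_one_restrict continuous_imp_baire_one) simp
    have "?g \<in> T"
      using g(2) F k by (intro V[OF gY]) (auto simp: subset_iff)
    moreover have "?g \<in> G k n"
      using gY g(2) \<Delta>(2)[of k] by (auto simp: G_def subset_iff)
    ultimately show "D n \<inter> T \<noteq> {}"
      using k(1) by (auto simp: D_def)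
  qed
  have "?Y closure_of (\<Inter>n. D n) = topspace ?Y"
    using B D_open D_dense unfolding baire_space_def by simp
  moreover have "restrict (\<lambda>_. 0) (topspace X) \<in> topspace ?Y"
    by (intro baire_one_restrict continuous_imp_baire_one) simp
  ultimately have "(\<Inter>n. D n) \<noteq> {}"
    by (metis closure_of_empty empty_iff)
  then obtain f where f: "\<And>n. f \<in> D n"
    by blast
  then have "\<forall>n. \<exists>k. k \<ge> n \<and> f \<in> G k n"
    by (auto simp: D_def)
  then obtain k where k: "\<And>n. k n \<ge> n" "\<And>n. f \<in> G (k n) n"
    by metis
  have "baire_one X f"
    using f[of 0] openin_subset[OF D_open[of 0]] topspace_B_1 by blast
  then obtain g where g: "\<And>j :: nat. continuous_map X euclideanreal (g j)"
      "\<And>x. x \<in> topspace X \<Longrightarrow> (\<lambda>j. g j x) \<longlonglongrightarrow> f x"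
    unfolding baire_one_def by metis
  have "\<exists>j. \<forall>x\<in>\<Delta> (k n). real n < \<bar>g j x\<bar>" for n
  proof -
    have "\<forall>x\<in>\<Delta> (k n). eventually (\<lambda>j. real n < \<bar>g j x\<bar>) sequentially"
    proof
      fix x assume x: "x \<in> \<Delta> (k n)"
      have "(\<lambda>j. \<bar>g j x\<bar>) \<longlonglongrightarrow> \<bar>f x\<bar>"
        using x \<Delta>(2) g(2) by (intro tendsto_rabs) blast
      moreover have "real n < \<bar>f x\<bar>"
        using k(2)[of n] x by (auto simp: G_def)
      ultimately show "eventually (\<lambda>j. real n < \<bar>g j x\<bar>) sequentially"
        by (rule order_tendstoD)
    qed
    then have "eventually (\<lambda>j. \<forall>x\<in>\<Delta> (k n). real n < \<bar>g j x\<bar>) sequentially"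
      using \<Delta>(1) by (rule eventually_ball_finite[rotated])
    then show ?thesis
      unfolding eventually_sequentially by blast
  qed
  then obtain j where j: "\<And>n. \<forall>x\<in>\<Delta> (k n). real n < \<bar>g (j n) x\<bar>"
    by metis
  show "\<exists>r :: nat \<Rightarrow> nat. strict_mono r \<and> strongly_point_finite X UNIV (\<Delta> \<circ> r)"
  proof (rule strongly_point_finite_subseq_of_large[of X "\<lambda>n. g (j n)" \<Delta> k])
    show "\<exists>M. \<forall>n. \<bar>g (j n) x\<bar> \<le> M" if "x \<in> topspace X" for x
    proof -
      have "Bseq (\<lambda>n. g n x)"
        using g(2)[OF that] by (intro convergent_imp_Bseq convergentI)
      then show ?thesis
        unfolding Bseq_def by auto
    qed
  qed (use g j k \<Delta> in auto)
qed

text \<open>The values at a point of \<open>A\<close> and the zeros on the rest of \<open>E\<close> are imposed by products of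
  finitely many separating functions; these products decrease, hence converge pointwise, as the
  finite subsets exhaust \<open>E\<close>.\<close>
lemma baire_one_interpolation:
  fixes v :: "'a \<Rightarrow> real"
  assumes X: "tychonoff_space X" and E: "countable E" "E \<subseteq> topspace X" and AE: "A \<subseteq> E"
    and \<phi>: "\<And>a. a \<in> A \<Longrightarrow> continuous_map X euclideanreal (\<phi> a)" "\<And>a. a \<in> A \<Longrightarrow> \<phi> a a = 1"
      "\<And>x. x \<in> topspace X \<Longrightarrow> finite {a \<in> A. \<phi> a x \<noteq> (0 :: real)}"
  obtains \<beta> where "baire_one X \<beta>" "\<And>x. x \<in> A \<Longrightarrow> \<beta> x = v x" "\<And>x. x \<in> E - A \<Longrightarrow> \<beta> x = 0"
proof -
  obtain \<psi> :: "'a \<Rightarrow> 'a \<Rightarrow> 'a \<Rightarrow> real" where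
    \<psi>: "\<And>a b. a \<in> topspace X \<Longrightarrow> b \<in> topspace X \<Longrightarrow> a \<noteq> b \<Longrightarrow> continuous_map X euclideanreal (\<psi> a b)"
      "\<And>a b x. a \<in> topspace X \<Longrightarrow> b \<in> topspace X \<Longrightarrow> a \<noteq> b \<Longrightarrow> x \<in> topspace X \<Longrightarrow> 0 \<le> \<psi> a b x \<and> \<psi> a b x \<le> 1"
      "\<And>a b. a \<in> topspace X \<Longrightarrow> b \<in> topspace X \<Longrightarrow> a \<noteq> b \<Longrightarrow> \<psi> a b a = 1 \<and> \<psi> a b b = 0"
    by (rule tychonoff_separating_functions[OF X]) blast
  define e where "e = to_nat_on E"
  have e: "inj_on e E"
    using E(1) by (simp add: e_def inj_on_to_nat_on)
  have finE: "finite {b \<in> E. e b \<le> j}" for j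
    using finite_vimage_IntI[OF finite_atMost[of j] e] by (simp add: vimage_def Int_def conj_commute)
  \<comment> \<open>Omitting \<open>a\<close> gives \<open>P a j a = 1\<close> for
    \<open>a \<in> A\<close>, while every other \<open>x \<in> E\<close> enters \<open>J a j\<close>
    once \<open>e x \<le> j\<close> and then annihilates the product at \<open>x\<close>.\<close>
  define J where "J a j = {b \<in> E. e b \<le> j \<and> b \<noteq> a}" for a j
  have J: "finite (J a j)" "J a j \<subseteq> E - {a}" for a j
    using finite_subset[OF _ finE[of j], of "J a j"] by (auto simp: J_def)
  define P where "P a j x = (\<Prod>b\<in>J a j. \<psi> a b x)" for a j x
  have P01: "0 \<le> \<psi> a b x \<and> \<psi> a b x \<le> 1" if "a \<in> A" "b \<in> J a j" "x \<in> topspace X" for a b j x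
    using \<psi>(2)[of a b x] that J(2) E AE by blast
  have P_cont: "continuous_map X euclideanreal (P a j)" if "a \<in> A" for a j
    unfolding P_def
  proof (intro continuous_map_prod J(1))
    fix b assume "b \<in> J a j"
    then show "continuous_map X euclideanreal (\<psi> a b)"
      using that J(2)[of a j] E AE by (intro \<psi>(1)) auto
  qed
  have P_conv: "convergent (\<lambda>j. P a j x)" if "a \<in> A" "x \<in> topspace X" for a x
  proof -
    have "P a (Suc j) x \<le> P a j x" for j
    proof -
      have "J a j \<subseteq> J a (Suc j)"
        by (auto simp: J_def)
      then have "P a (Suc j) x = (\<Prod>b\<in>J a (Suc j) - J a j. \<psi> a b x) * P a j x"
        unfolding P_def by (rule prod.subset_diff[OF _ J(1)])
      also have "\<dots> \<le> P a j x"
        using P01[OF that(1) _ that(2)] unfolding P_def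
        by (intro mult_left_le_one_le prod_nonneg prod_le_1) blast+
      finally show ?thesis .
    qed
    then have "decseq (\<lambda>j. P a j x)"
      by (rule decseq_SucI)
    moreover have "0 \<le> P a j x" for j
      unfolding P_def using P01 that by (intro prod_nonneg) blast
    ultimately obtain L where "(\<lambda>j. P a j x) \<longlonglongrightarrow> L"
      using decseq_convergent[of "\<lambda>j. P a j x" 0] by blast
    then show ?thesis
      by (rule convergentI)
  qed
  \<comment> \<open>The cut-off \<open>e a \<le> j\<close> leaves a finite, hence continuous, sum.
    At a fixed \<open>x\<close> it eventually admits every \<open>a\<close> with
    \<open>\<phi> a x \<noteq> 0\<close>, so the limit does not see it.\<close>
  define \<beta>n where "\<beta>n j x = (\<Sum>a\<in>{a \<in> A. e a \<le> j}. v a * \<phi> a x * P a j x)" for j x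
  have finA: "finite {a \<in> A. e a \<le> j}" for j
    by (rule finite_subset[OF _ finE[of j]]) (use AE in auto)
  define S where "S x = {a \<in> A. \<phi> a x \<noteq> 0}" for x
  define \<beta> where "\<beta> x = (\<Sum>a\<in>S x. v a * \<phi> a x * lim (\<lambda>j. P a j x))" for x
  have lim: "(\<lambda>j. \<beta>n j x) \<longlonglongrightarrow> \<beta> x" if x: "x \<in> topspace X" for x
  proof -
    have S: "finite (S x)" "S x \<subseteq> A"
      using \<phi>(3) x by (auto simp: S_def)
    have "(\<lambda>j. \<Sum>a\<in>S x. v a * \<phi> a x * P a j x) \<longlonglongrightarrow> \<beta> x"
      unfolding \<beta>_def using S P_conv x
      by (intro tendsto_sum tendsto_mult tendsto_const) (auto simp: convergent_LIMSEQ_iff)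
    moreover have "eventually (\<lambda>j. (\<Sum>a\<in>S x. v a * \<phi> a x * P a j x) = \<beta>n j x) sequentially"
    proof (rule eventually_sequentiallyI)
      fix j assume j: "Max (insert 0 (e ` S x)) \<le> j"
      have "e a \<le> j" if "a \<in> S x" for a
        using j that S(1) by simp
      then show "(\<Sum>a\<in>S x. v a * \<phi> a x * P a j x) = \<beta>n j x"
        unfolding \<beta>n_def by (intro sum.mono_neutral_left finA) (auto simp: S_def)
    qed
    ultimately show ?thesis
      by (rule Lim_transform_eventually)
  qed
  have P_0: "lim (\<lambda>j. P a j x) = 0" if "x \<in> E" "a \<in> A" "a \<noteq> x" for a x
  proof -
    have "eventually (\<lambda>j. P a j x = 0) sequentially"
    proof (rule eventually_sequentiallyI)
      fix j assume "e x \<le> j"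
      then have "x \<in> J a j"
        using that by (auto simp: J_def)
      moreover have "\<psi> a x x = 0"
        using \<psi>(3)[of a x] that E AE by blast
      ultimately show "P a j x = 0"
        unfolding P_def using J(1) by (meson prod_zero)
    qed
    then show ?thesis
      by (intro limI tendsto_eventually)
  qed
  have \<beta>_A: "\<beta> x = v x" if "x \<in> A" for x
  proof -
    have "x \<in> topspace X" "x \<in> E"
      using that AE E by auto
    have "P x j x = 1" for j
      unfolding P_def using \<psi>(3)[of x] J(2)[of x j] \<open>x \<in> topspace X\<close> E by (intro prod.neutral) blast
    then have "lim (\<lambda>j. P x j x) = 1"
      by simp
    moreover have "\<beta> x = (\<Sum>a\<in>{x}. v a * \<phi> a x * lim (\<lambda>j. P a j x))"
      unfolding \<beta>_def using \<phi>(2)[OF that] \<phi>(3)[OF \<open>x \<in> topspace X\<close>] P_0[OF \<open>x \<in> E\<close>] that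
      by (intro sum.mono_neutral_right) (auto simp: S_def)
    ultimately show ?thesis
      using \<phi>(2)[OF that] by simp
  qed
  have \<beta>_E: "\<beta> x = 0" if "x \<in> E - A" for x
    unfolding \<beta>_def using P_0[of x] that by (intro sum.neutral) (auto simp: S_def)
  have "continuous_map X euclideanreal (\<beta>n j)" for j
    unfolding \<beta>n_def using \<phi>(1) P_cont by (intro continuous_intros finA) auto
  then have "baire_one X \<beta>"
    unfolding baire_one_def using lim by (intro exI[of _ \<beta>n]) simp
  then show thesis
    using \<beta>_A \<beta>_E by (rule that)
qed

text \<open>A state \<open>(g, v, \<epsilon>)\<close> stands for the functions that are \<open>\<epsilon>\<close>-close to \<open>g + v\<close> on the current finite set
  \<open>E\<close>. The continuous part \<open>g\<close> is only corrected by a uniformly small amount, whereas \<open>v\<close> may change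
  arbitrarily, but only on \<open>E' - E\<close>.\<close>
definition state_refines :: "'a topology \<Rightarrow> ('a \<Rightarrow> real) set \<Rightarrow> 'a set \<Rightarrow> 'a set \<Rightarrow>
    ('a \<Rightarrow> real) \<times> ('a \<Rightarrow> real) \<times> real \<Rightarrow> ('a \<Rightarrow> real) \<times> ('a \<Rightarrow> real) \<times> real \<Rightarrow> bool" where
  "state_refines X D E E' = (\<lambda>(g, v, \<epsilon>) (g', v', \<epsilon>').
     continuous_map X euclideanreal g' \<and> (\<forall>x\<in>topspace X. \<bar>g' x - g x\<bar> \<le> \<epsilon> / 2) \<and>
     (\<forall>x. x \<notin> E' - E \<longrightarrow> v' x = v x) \<and> 0 < \<epsilon>' \<and> \<epsilon>' \<le> \<epsilon> / 2 \<and>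
     (\<forall>f\<in>topspace (B_1 X). (\<forall>x\<in>E'. \<bar>f x - (g' x + v' x)\<bar> \<le> \<epsilon>') \<longrightarrow> f \<in> D))"

definition good_state :: "'a topology \<Rightarrow> ('a \<Rightarrow> real) \<times> ('a \<Rightarrow> real) \<times> real \<Rightarrow> bool" where
  "good_state X = (\<lambda>(g, v, \<epsilon>). continuous_map X euclideanreal g \<and> 0 < \<epsilon>)"

lemma state_refines_good_state: "state_refines X D E E' s s' \<Longrightarrow> good_state X s'"
  by (auto simp: state_refines_def good_state_def)

text \<open>A larger finite set frees \<open>v\<close> at more points and tests closeness at more
  points, so both conditions become weaker. This lets several states share one
  \<open>E'\<close>.\<close>

lemma state_refines_mono:
  assumes "state_refines X D E E1 s s'" "E1 \<subseteq> E2"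
  shows "state_refines X D E E2 s s'"
  using assms unfolding state_refines_def by (auto split: prod.splits) blast+

text \<open>Density gives \<open>f \<in> D\<close> close to \<open>g + v\<close> on
  \<open>E\<close>, and a finite \<open>F\<close> controls membership in \<open>D\<close> near
  \<open>f\<close>. On \<open>E\<close> the discrepancy is small and goes into \<open>g\<close>
  through \<open>c\<close>; on \<open>F - E\<close> it may be large and is absorbed by
  \<open>v\<close>. Thus \<open>g' + v'\<close> equals \<open>f\<close> on \<open>F\<close>.\<close>

lemma state_refines_exists:
  assumes X: "tychonoff_space X" and D: "openin (B_1 X) D" "B_1 X closure_of D = topspace (B_1 X)"
    and E: "finite E" "E \<subseteq> topspace X" and s: "good_state X s"
  obtains E' s' where "finite E'" "E' \<subseteq> topspace X" "state_refines X D E E' s s'"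
proof -
  obtain g v \<epsilon> where s_eq: "s = (g, v, \<epsilon>)"
    by (cases s)
  have g: "continuous_map X euclideanreal g" and \<epsilon>: "\<epsilon> > 0"
    using s by (auto simp: good_state_def s_eq)
  define p where "p x = g x + v x" for x
  \<comment> \<open>\<open>p\<close> need not be Baire-one because \<open>v\<close> is arbitrary; a
    continuous function with the same values on \<open>E\<close> shows that \<open>T\<close> is
    nonempty.\<close>
  obtain g0 where g0: "continuous_map X (top_of_set UNIV) g0" "\<And>x. x \<in> E \<Longrightarrow> g0 x = p x"
    by (rule tychonoff_finite_interpolation[OF X E, of UNIV p]) auto
  define T where "T = {f \<in> topspace (B_1 X). \<forall>x\<in>E. \<bar>f x - p x\<bar> < \<epsilon> / 2}"
  have "openin (B_1 X) T"
    unfolding T_def B_1_eq_pointwise by (rule openin_pointwise_box[OF E])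
  moreover have "restrict g0 (topspace X) \<in> topspace (B_1 X)"
    using g0(1) by (intro baire_one_restrict continuous_imp_baire_one) simp
  then have "restrict g0 (topspace X) \<in> T"
    using g0(2) E \<epsilon> by (auto simp: T_def subset_iff)
  ultimately have "D \<inter> T \<noteq> {}"
    using D(2) unfolding dense_intersects_open by blast
  then obtain f where f: "f \<in> D" "f \<in> T"
    by blast
  obtain F \<delta> where F: "finite F" "F \<subseteq> topspace X" "\<delta> > 0"
      and FD: "\<And>h. h \<in> topspace (B_1 X) \<Longrightarrow> (\<And>x. x \<in> F \<Longrightarrow> \<bar>h x - f x\<bar> < \<delta>) \<Longrightarrow> h \<in> D"
    using openin_pointwise_contains_box[OF D(1)[unfolded B_1_eq_pointwise] f(1)]
    unfolding B_1_eq_pointwise by metis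
  obtain c where c: "continuous_map X (top_of_set {-(\<epsilon>/2)..\<epsilon>/2}) c" "\<And>x. x \<in> E \<Longrightarrow> c x = f x - p x"
  proof (rule tychonoff_finite_interpolation[OF X E, of "{-(\<epsilon>/2)..\<epsilon>/2}" "\<lambda>x. f x - p x"])
    show "(\<lambda>x. f x - p x) ` E \<subseteq> {-(\<epsilon>/2)..\<epsilon>/2}"
    proof (rule image_subsetI)
      fix x assume "x \<in> E"
      then have "\<bar>f x - p x\<bar> < \<epsilon> / 2"
        using f(2) by (simp add: T_def)
      then show "f x - p x \<in> {-(\<epsilon>/2)..\<epsilon>/2}"
        unfolding atLeastAtMost_iff by linarith
    qed
  qed (use \<epsilon> in auto)
  define g' where "g' x = g x + c x" for x
  define v' where "v' x = (if x \<in> F - E then f x - g' x else v x)" for x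
  \<comment> \<open>Half of \<open>\<delta>\<close> turns the non-strict closeness into the strict
    one; half of \<open>\<epsilon>\<close> lets the later corrections of \<open>g\<close>
    telescope.\<close>
  define \<epsilon>' where "\<epsilon>' = min (\<delta> / 2) (\<epsilon> / 2)"
  have "continuous_map X euclideanreal g'"
    unfolding g'_def using c(1) g by (intro continuous_map_add) (auto simp: continuous_map_in_subtopology)
  moreover have "\<bar>g' x - g x\<bar> \<le> \<epsilon> / 2" if "x \<in> topspace X" for x
  proof -
    have "c x \<in> {-(\<epsilon>/2)..\<epsilon>/2}"
      using c(1) that by (auto simp: continuous_map_in_subtopology)
    then show ?thesis
      by (auto simp: g'_def abs_le_iff)
  qed
  moreover have "h \<in> D" if h: "h \<in> topspace (B_1 X)" "\<forall>x\<in>E \<union> F. \<bar>h x - (g' x + v' x)\<bar> \<le> \<epsilon>'" for h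
  proof (rule FD[OF h(1)])
    fix x assume x: "x \<in> F"
    have "g' x + v' x = f x"
      using x c(2)[of x] by (auto simp: v'_def g'_def p_def)
    moreover have "\<epsilon>' < \<delta>"
      using F(3) by (auto simp: \<epsilon>'_def)
    ultimately show "\<bar>h x - f x\<bar> < \<delta>"
      using bspec[OF h(2), of x] x by simp
  qed
  ultimately have "state_refines X D E (E \<union> F) s (g', v', \<epsilon>')"
    unfolding state_refines_def s_eq using \<epsilon> F(3) by (auto simp: v'_def \<epsilon>'_def)
  then show thesis
    using that[of "E \<union> F"] E F by blast
qed

text \<open>All plays move at once, and finiteness of \<open>\<Sigma>\<close> keeps their common
  \<open>E'\<close> finite. The old states remain in \<open>\<Sigma>'\<close> on behalf of the plays
  that skip this block.\<close>

lemma state_refines_family_exists: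
  assumes X: "tychonoff_space X" and D: "openin (B_1 X) D" "B_1 X closure_of D = topspace (B_1 X)"
    and E: "finite E" "E \<subseteq> topspace X" and \<Sigma>: "finite \<Sigma>" "\<And>s. s \<in> \<Sigma> \<Longrightarrow> good_state X s"
  obtains E' \<Sigma>' where "finite E'" "E' \<subseteq> topspace X" "E \<subseteq> E'" "finite \<Sigma>'" "\<Sigma> \<subseteq> \<Sigma>'"
    "\<And>s. s \<in> \<Sigma>' \<Longrightarrow> good_state X s" "\<And>s. s \<in> \<Sigma> \<Longrightarrow> \<exists>s'\<in>\<Sigma>'. state_refines X D E E' s s'"
proof -
  have "\<forall>s\<in>\<Sigma>. \<exists>E' s'. finite E' \<and> E' \<subseteq> topspace X \<and> state_refines X D E E' s s'"
    using state_refines_exists[OF X D E \<Sigma>(2)] by metis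
  then obtain F t where Ft: "\<And>s. s \<in> \<Sigma> \<Longrightarrow> finite (F s) \<and> F s \<subseteq> topspace X \<and> state_refines X D E (F s) s (t s)"
    by metis
  define E' where "E' = E \<union> (\<Union>s\<in>\<Sigma>. F s)"
  have ref: "state_refines X D E E' s (t s)" if "s \<in> \<Sigma>" for s
    by (rule state_refines_mono[of X D E "F s"]) (use Ft that in \<open>auto simp: E'_def\<close>)
  show thesis
  proof (rule that[of E' "\<Sigma> \<union> t ` \<Sigma>"])
    show "finite E'" "E' \<subseteq> topspace X"
      unfolding E'_def using E \<Sigma>(1) Ft by blast+
    show "good_state X s" if "s \<in> \<Sigma> \<union> t ` \<Sigma>" for s
      using that \<Sigma>(2) ref state_refines_good_state by blast
  qed (use \<Sigma>(1) ref in \<open>auto simp: E'_def\<close>)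
qed

section \<open>Dense open sets and the Baire property of \<open>B_1 X\<close>\<close>

lemma dense_open_Int:
  assumes "openin Y U" "Y closure_of U = topspace Y" "Y closure_of V = topspace Y"
  shows "Y closure_of (U \<inter> V) = topspace Y"
  unfolding dense_intersects_open
proof (intro strip)
  fix T assume T: "openin Y T \<and> T \<noteq> {}"
  then have "U \<inter> T \<noteq> {}"
    using assms(2) unfolding dense_intersects_open by blast
  moreover have "openin Y (U \<inter> T)"
    using assms(1) T by blast
  ultimately have "V \<inter> (U \<inter> T) \<noteq> {}"
    using assms(3) unfolding dense_intersects_open by blast
  then show "U \<inter> V \<inter> T \<noteq> {}"
    by blast
qed

lemma dense_open_finite_INT:
  fixes D :: "nat \<Rightarrow> 'a set"
  assumes "\<And>n. openin Y (D n)" "\<And>n. Y closure_of (D n) = topspace Y"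
  shows "openin Y (\<Inter>i\<le>n. D i) \<and> Y closure_of (\<Inter>i\<le>n. D i) = topspace Y"
proof (induction n)
  case (Suc n)
  then show ?case
    using assms by (simp add: atMost_Suc openin_Int dense_open_Int)
qed (use assms in simp)

lemma property_kappa_imp_baire_B_1:
  assumes X: "tychonoff_space X" and \<kappa>: "property_kappa X"
  shows "baire_space (B_1 X)"
  unfolding baire_space_def
proof (intro strip)
  let ?Y = "B_1 X"
  fix D :: "nat \<Rightarrow> ('a \<Rightarrow> real) set"
  assume D: "\<forall>n. openin ?Y (D n) \<and> ?Y closure_of (D n) = topspace ?Y"
  \<comment> \<open>The final play moves only at the stages \<open>r n\<close>. With decreasing
    sets, \<open>n \<le> r n\<close> still brings its limit into every \<open>D n\<close>.\<close>
  define D' where "D' n = (\<Inter>i\<le>n. D i)" for n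
  have D': "openin ?Y (D' n)" "?Y closure_of (D' n) = topspace ?Y" for n
    using dense_open_finite_INT[of ?Y D n] D unfolding D'_def by blast+
  show "?Y closure_of (\<Inter>n. D n) = topspace ?Y"
    unfolding dense_intersects_open
  proof (intro strip)
    fix T assume T: "openin ?Y T \<and> T \<noteq> {}"
    then obtain f0 where f0: "f0 \<in> T"
      by blast
    obtain E0 \<epsilon>0 where E0: "finite E0" "E0 \<subseteq> topspace X" "\<epsilon>0 > 0"
        and E0_T: "\<And>h. h \<in> topspace ?Y \<Longrightarrow> (\<And>x. x \<in> E0 \<Longrightarrow> \<bar>h x - f0 x\<bar> < \<epsilon>0) \<Longrightarrow> h \<in> T"
      using openin_pointwise_contains_box[OF conjunct1[OF T, unfolded B_1_eq_pointwise] f0]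
      unfolding B_1_eq_pointwise by metis
    obtain g0 where g0: "continuous_map X (top_of_set UNIV) g0" "\<And>x. x \<in> E0 \<Longrightarrow> g0 x = f0 x"
      by (rule tychonoff_finite_interpolation[OF X E0(1,2), of UNIV f0]) auto
    \<comment> \<open>The total drift of \<open>g\<close> is at most the initial tolerance, so
      starting with \<open>\<epsilon>0 / 2\<close> leaves the limit strictly within
      \<open>\<epsilon>0\<close> of \<open>f0\<close> on \<open>E0\<close>.\<close>
    define s0 :: "('a \<Rightarrow> real) \<times> ('a \<Rightarrow> real) \<times> real" where "s0 = (g0, (\<lambda>_. 0), \<epsilon>0 / 2)"
    have s0: "good_state X s0"
      using g0(1) E0(3) by (simp add: s0_def good_state_def)
    define inv where "inv n p \<longleftrightarrow> (n = 0 \<longrightarrow> p = (E0, {s0})) \<and> finite (fst p) \<and> fst p \<subseteq> topspace X \<and>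
        finite (snd p) \<and> (\<forall>s\<in>snd p. good_state X s)" for n :: nat and p
    define nxt where "nxt n p q \<longleftrightarrow> fst p \<subseteq> fst q \<and> snd p \<subseteq> snd q \<and>
        (\<forall>s\<in>snd p. \<exists>s'\<in>snd q. state_refines X (D' n) (fst p) (fst q) s s')" for n p q
    have "\<exists>q. \<forall>n. inv n (q n) \<and> nxt n (q n) (q (Suc n))"
    proof (rule dependent_nat_choice)
      show "\<exists>p. inv 0 p"
        using E0 s0 by (auto simp: inv_def)
    next
      fix p n assume "inv n p"
      then obtain E' \<Sigma>' where "finite E'" "E' \<subseteq> topspace X" "fst p \<subseteq> E'" "finite \<Sigma>'" "snd p \<subseteq> \<Sigma>'"
        "\<And>s. s \<in> \<Sigma>' \<Longrightarrow> good_state X s" "\<And>s. s \<in> snd p \<Longrightarrow> \<exists>s'\<in>\<Sigma>'. state_refines X (D' n) (fst p) E' s s'"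
        using state_refines_family_exists[OF X D'[of n], of "fst p" "snd p"] unfolding inv_def by metis
      then show "\<exists>q. inv (Suc n) q \<and> nxt n p q"
        by (intro exI[of _ "(E', \<Sigma>')"]) (simp add: inv_def nxt_def)
    qed
    then obtain q where q: "\<And>n. inv n (q n)" "\<And>n. nxt n (q n) (q (Suc n))"
      by blast
    define E where "E n = fst (q n)" for n
    define \<Sigma> where "\<Sigma> n = snd (q n)" for n
    have E: "finite (E n)" "E n \<subseteq> topspace X" for n
      using q(1)[of n] by (auto simp: inv_def E_def)
    have E_0: "E 0 = E0" and \<Sigma>_0: "\<Sigma> 0 = {s0}"
      using q(1)[of 0] by (auto simp: inv_def E_def \<Sigma>_def)
    have E_Suc: "E n \<subseteq> E (Suc n)" and \<Sigma>_Suc: "\<Sigma> n \<subseteq> \<Sigma> (Suc n)"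
        and \<Sigma>_ref: "\<And>s. s \<in> \<Sigma> n \<Longrightarrow> \<exists>s'\<in>\<Sigma> (Suc n). state_refines X (D' n) (E n) (E (Suc n)) s s'" for n
      using q(2)[of n] by (auto simp: nxt_def E_def \<Sigma>_def)
    have E_mono: "E m \<subseteq> E n" and \<Sigma>_mono: "\<Sigma> m \<subseteq> \<Sigma> n" if "m \<le> n" for m n
      using lift_Suc_mono_le[of E, OF E_Suc that] lift_Suc_mono_le[of \<Sigma>, OF \<Sigma>_Suc that] by auto
    define \<Delta> where "\<Delta> n = E (Suc n) - E n" for n
    have "disjoint_family \<Delta>"
      unfolding \<Delta>_def by (rule disjoint_family_Suc) (rule E_Suc)
    then have dfs: "disjoint_finite_seq X \<Delta>"
      using E by (auto simp: disjoint_finite_seq_def \<Delta>_def)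
    obtain r :: "nat \<Rightarrow> nat" and \<phi> :: "'a \<Rightarrow> 'a \<Rightarrow> real" where r: "strict_mono r"
        and \<phi>: "\<And>a. a \<in> (\<Union>n. \<Delta> (r n)) \<Longrightarrow> continuous_map X euclideanreal (\<phi> a)"
          "\<And>a. a \<in> (\<Union>n. \<Delta> (r n)) \<Longrightarrow> \<phi> a a = 1"
          "\<And>x. x \<in> topspace X \<Longrightarrow> finite {a \<in> (\<Union>n. \<Delta> (r n)). \<phi> a x \<noteq> 0}"
      by (rule property_kappa_bump_functions[OF X \<kappa> dfs]) blast
    have r_Suc: "Suc (r k) \<le> r j" if "k < j" for j k
      using strict_monoD[OF r that] by simp
    define A where "A = (\<Union>n. \<Delta> (r n))"
    \<comment> \<open>States are never discarded, so the one reached earlier is still available in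
      \<open>\<Sigma> (r k)\<close>. It is refined relative to all of \<open>E (r k)\<close>,
      skipped blocks included, so \<open>v\<close> changes on \<open>\<Delta> (r k)\<close>
      only.\<close>
    have "\<exists>s. \<forall>k. (s k \<in> \<Sigma> (r k) \<and> (k = 0 \<longrightarrow> s k = s0)) \<and>
        state_refines X (D' (r k)) (E (r k)) (E (Suc (r k))) (s k) (s (Suc k))"
    proof (rule dependent_nat_choice)
      show "\<exists>s. s \<in> \<Sigma> (r 0) \<and> (0 = (0::nat) \<longrightarrow> s = s0)"
        using \<Sigma>_mono[of 0 "r 0"] \<Sigma>_0 by (intro exI[of _ s0]) simp
    next
      fix s k assume "s \<in> \<Sigma> (r k) \<and> (k = 0 \<longrightarrow> s = s0)"
      then obtain s' where s': "s' \<in> \<Sigma> (Suc (r k))" "state_refines X (D' (r k)) (E (r k)) (E (Suc (r k))) s s'"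
        using \<Sigma>_ref by blast
      have "s' \<in> \<Sigma> (r (Suc k))"
        using s'(1) \<Sigma>_mono[OF r_Suc[of k "Suc k"]] by auto
      with s'(2) show "\<exists>s'. (s' \<in> \<Sigma> (r (Suc k)) \<and> (Suc k = 0 \<longrightarrow> s' = s0)) \<and>
          state_refines X (D' (r k)) (E (r k)) (E (Suc (r k))) s s'"
        by blast
    qed
    then obtain s where s: "\<And>k. s k \<in> \<Sigma> (r k)" "s 0 = s0"
        "\<And>k. state_refines X (D' (r k)) (E (r k)) (E (Suc (r k))) (s k) (s (Suc k))"
      by metis
    define g where "g k = fst (s k)" for k
    define v where "v k = fst (snd (s k))" for k
    define \<epsilon> where "\<epsilon> k = snd (snd (s k))" for k
    have s_eq: "s k = (g k, v k, \<epsilon> k)" for k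
      by (simp add: g_def v_def \<epsilon>_def)
    have "good_state X (s k)" for k
      using s(1)[of k] q(1)[of "r k"] by (auto simp: \<Sigma>_def inv_def)
    then have g_cont: "continuous_map X euclideanreal (g k)" and \<epsilon>_pos: "0 < \<epsilon> k" for k
      by (auto simp: s_eq good_state_def)
    have g_step: "\<And>x. x \<in> topspace X \<Longrightarrow> \<bar>g (Suc k) x - g k x\<bar> \<le> \<epsilon> k / 2"
        and v_step: "\<And>x. x \<notin> \<Delta> (r k) \<Longrightarrow> v (Suc k) x = v k x"
        and \<epsilon>_step: "\<epsilon> (Suc k) \<le> \<epsilon> k / 2"
        and D_step: "\<And>f. f \<in> topspace ?Y \<Longrightarrow> (\<And>x. x \<in> E (Suc (r k)) \<Longrightarrow>
            \<bar>f x - (g (Suc k) x + v (Suc k) x)\<bar> \<le> \<epsilon> (Suc k)) \<Longrightarrow> f \<in> D' (r k)" for k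
      using s(3)[of k] unfolding s_eq state_refines_def \<Delta>_def by auto
    have g_0: "g 0 = g0" and v_0: "v 0 = (\<lambda>_. 0)" and \<epsilon>_0: "\<epsilon> 0 = \<epsilon>0 / 2"
      using s(2) by (simp_all add: s_eq s0_def)
    \<comment> \<open>The steps telescope because
      \<open>\<epsilon> k / 2 \<le> \<epsilon> k - \<epsilon> (Suc k)\<close>.\<close>
    have g_dist: "\<bar>g m x - g k x\<bar> \<le> \<epsilon> k - \<epsilon> m" if "k \<le> m" "x \<in> topspace X" for k m x
      using that(1)
    proof (induction m rule: dec_induct)
      case (step m)
      then show ?case
        using g_step[OF that(2), of m] \<epsilon>_step[of m] by linarith
    qed simp
    have "convergent (\<lambda>k. g k x)" if x: "x \<in> topspace X" for x
    proof -
      have "\<epsilon> (Suc k) \<le> \<epsilon> k" for k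
        using \<epsilon>_step[of k] \<epsilon>_pos[of k] by linarith
      then have "decseq \<epsilon>"
        by (rule decseq_SucI)
      then have "Cauchy \<epsilon>"
        using \<epsilon>_pos by (metis LIMSEQ_imp_Cauchy decseq_convergent less_imp_le)
      have "Cauchy (\<lambda>k. g k x)"
        unfolding Cauchy_altdef2
      proof (intro allI impI)
        fix e :: real assume "e > 0"
        then obtain N where N: "\<And>n. n \<ge> N \<Longrightarrow> dist (\<epsilon> n) (\<epsilon> N) < e"
          using \<open>Cauchy \<epsilon>\<close> unfolding Cauchy_altdef2 by blast
        have "dist (g n x) (g N x) < e" if "n \<ge> N" for n
          using g_dist[OF that x] N[OF that] by (simp add: dist_real_def)
        then show "\<exists>N. \<forall>n\<ge>N. dist (g n x) (g N x) < e"
          by blast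
      qed
      then show ?thesis
        by (simp add: Cauchy_convergent_iff)
    qed
    then have lim: "(\<lambda>k. g k x) \<longlonglongrightarrow> lim (\<lambda>k. g k x)" if "x \<in> topspace X" for x
      using that by (simp add: convergent_LIMSEQ_iff)
    define \<gamma> where "\<gamma> x = lim (\<lambda>k. g k x)" for x
    have \<gamma>_baire: "baire_one X \<gamma>"
      unfolding baire_one_def \<gamma>_def using g_cont lim by (intro exI[of _ g]) simp
    have \<gamma>_dist: "\<bar>\<gamma> x - g k x\<bar> \<le> \<epsilon> k" if x: "x \<in> topspace X" for k x
    proof (rule Lim_bounded[of "\<lambda>m. \<bar>g m x - g k x\<bar>" _ k])
      show "(\<lambda>m. \<bar>g m x - g k x\<bar>) \<longlonglongrightarrow> \<bar>\<gamma> x - g k x\<bar>"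
        unfolding \<gamma>_def by (intro tendsto_intros lim x)
      show "\<forall>m\<ge>k. \<bar>g m x - g k x\<bar> \<le> \<epsilon> k"
        using g_dist[OF _ x] \<epsilon>_pos by (smt (verit))
    qed
    have v_stable: "v m x = v (Suc k) x" if "x \<in> E (Suc (r k))" "Suc k \<le> m" for x k m
      using that(2)
    proof (induction m rule: dec_induct)
      case (step m)
      have "x \<in> E (r m)"
        using that(1) E_mono[OF r_Suc[of k m]] step.hyps by auto
      then show ?case
        using v_step[of x m] step.IH by (simp add: \<Delta>_def)
    qed simp
    have v_zero: "v m x = 0" if "x \<notin> A" for x m
    proof (induction m)
      case (Suc m)
      then show ?case
        using that v_step[of x m] by (auto simp: A_def)
    qed (simp add: v_0)
    have "\<forall>x\<in>A. \<exists>k. x \<in> \<Delta> (r k)"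
      by (auto simp: A_def)
    then obtain K where K: "\<And>x. x \<in> A \<Longrightarrow> x \<in> \<Delta> (r (K x))"
      by metis
    \<comment> \<open>The final values of \<open>v\<close>, extended by zero, need not form a
      Baire-one function, since a point need not be a G_\<delta> set. \<open>\<beta>\<close> copies
      them on the union of the \<open>E n\<close>, where the conditions for \<open>D'\<close> are
      tested; this includes the skipped points, where the value must be zero.\<close>
    obtain \<beta> where \<beta>: "baire_one X \<beta>" "\<And>x. x \<in> A \<Longrightarrow> \<beta> x = v (Suc (K x)) x"
        "\<And>x. x \<in> (\<Union>n. E n) - A \<Longrightarrow> \<beta> x = 0"
    proof (rule baire_one_interpolation[OF X, of "\<Union>n. E n" A \<phi> "\<lambda>x. v (Suc (K x)) x"])
      show "countable (\<Union>n. E n)"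
        using E(1) by (auto intro: countable_finite)
      show "(\<Union>n. E n) \<subseteq> topspace X"
        using E(2) by blast
      show "A \<subseteq> (\<Union>n. E n)"
        by (auto simp: A_def \<Delta>_def)
    qed (use \<phi> in \<open>auto simp: A_def\<close>)
    have \<beta>_eq: "\<beta> x = v (Suc k) x" if x: "x \<in> E (Suc (r k))" for x k
    proof (cases "x \<in> A")
      case True
      have "x \<in> E (Suc (r (K x)))" "x \<notin> E (r (K x))"
        using K[OF True] by (auto simp: \<Delta>_def)
      then have "\<not> k < K x"
        using x E_mono[OF r_Suc[of k "K x"]] by auto
      then have "v (Suc k) x = v (Suc (K x)) x"
        by (intro v_stable) (use \<open>x \<in> E (Suc (r (K x)))\<close> in auto)
      then show ?thesis
        using \<beta>(2) True by simp
    next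
      case False
      then show ?thesis
        using \<beta>(3)[of x] v_zero[OF False] x by auto
    qed
    define f where "f = restrict (\<lambda>x. \<gamma> x + \<beta> x) (topspace X)"
    have f: "f \<in> topspace ?Y"
      unfolding f_def by (intro baire_one_restrict baire_one_add \<gamma>_baire \<beta>(1))
    have "f \<in> D n" for n
    proof -
      have "f \<in> D' (r n)"
      proof (rule D_step[OF f])
        fix x assume x: "x \<in> E (Suc (r n))"
        then have "x \<in> topspace X"
          using E(2) by blast
        then show "\<bar>f x - (g (Suc n) x + v (Suc n) x)\<bar> \<le> \<epsilon> (Suc n)"
          using \<gamma>_dist[of x "Suc n"] \<beta>_eq[OF x] by (simp add: f_def)
      qed
      moreover have "n \<le> r n"
        using r by (rule strict_mono_imp_increasing)
      ultimately show ?thesis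
        by (auto simp: D'_def)
    qed
    moreover have "f \<in> T"
    proof (rule E0_T[OF f])
      fix x assume x: "x \<in> E0"
      have "x \<in> E n" for n
        using x E_0 E_mono[of 0 n] by auto
      then have "\<beta> x = 0"
        by (intro \<beta>(3)) (auto simp: A_def \<Delta>_def)
      then show "\<bar>f x - f0 x\<bar> < \<epsilon>0"
        using \<gamma>_dist[of x 0] g0(2)[OF x] x E0(2,3) by (auto simp: f_def g_0 \<epsilon>_0)
    qed
    ultimately show "(\<Inter>n. D n) \<inter> T \<noteq> {}"
      by blast
  qed
qed

theorem corollary3p2:
  fixes X :: "'a topology"
  assumes "tychonoff_space X"
  shows "(property_kappa X \<longleftrightarrow> kappa_frechet_urysohn (C_p X)) \<and>
         (property_kappa X \<longleftrightarrow> kappa_frechet_urysohn (C_p_unit X)) \<and>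
         (property_kappa X \<longleftrightarrow> ascoli_space (C_p X)) \<and>
         (property_kappa X \<longleftrightarrow> \<not> banakh_property (C_p X)) \<and>
         (property_kappa X \<longleftrightarrow>
            (\<forall>\<Delta> :: nat \<Rightarrow> 'a set. disjoint_finite_seq X \<Delta> \<and> (\<forall>n. \<Delta> n \<noteq> {}) \<longrightarrow>
               (\<exists>r :: nat \<Rightarrow> nat. strict_mono r \<and>
                  strongly_coz_delta_disjoint_seq X (\<Delta> \<circ> r)))) \<and>
         (property_kappa X \<longleftrightarrow> baire_space (B_1 X))"
proof -
  have FU: "property_kappa X \<longleftrightarrow> kappa_frechet_urysohn (C_p X)"
    using property_kappa_imp_kappa_frechet_urysohn[OF assms, of UNIV]
      kappa_frechet_urysohn_imp_property_kappa[OF assms, of UNIV]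
    by (auto simp: C_p_eq_pointwise)
  moreover have "property_kappa X \<longleftrightarrow> kappa_frechet_urysohn (C_p_unit X)"
    using property_kappa_imp_kappa_frechet_urysohn[OF assms, of "{0..1}"]
      kappa_frechet_urysohn_imp_property_kappa[OF assms, of "{0..1}"]
    by (auto simp: C_p_unit_eq_pointwise)
  moreover have "property_kappa X \<longleftrightarrow> ascoli_space (C_p X)"
    using FU kappa_frechet_urysohn_imp_ascoli ascoli_imp_property_kappa[OF assms] by blast
  moreover have "property_kappa X \<longleftrightarrow> \<not> banakh_property (C_p X)"
    using FU kappa_frechet_urysohn_imp_not_banakh not_banakh_imp_property_kappa[OF assms] by blast
  moreover have "property_kappa X \<longleftrightarrow>
      (\<forall>\<Delta> :: nat \<Rightarrow> 'a set. disjoint_finite_seq X \<Delta> \<and> (\<forall>n. \<Delta> n \<noteq> {}) \<longrightarrow>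
         (\<exists>r :: nat \<Rightarrow> nat. strict_mono r \<and> strongly_coz_delta_disjoint_seq X (\<Delta> \<circ> r)))"
    using property_kappa_imp_coz_delta_subsequence[OF assms] coz_delta_subsequences_imp_property_kappa
    by metis
  moreover have "property_kappa X \<longleftrightarrow> baire_space (B_1 X)"
    using property_kappa_imp_baire_B_1[OF assms] baire_B_1_imp_property_kappa[OF assms] by blast
  ultimately show ?thesis
    by blast
qed

end
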